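(* Let $K$ be an algebraically closed field of characteristic $p\ge 0$, let $k,n\ge2$ be integers with $(k-1)(n-1)>2$ and, if $p>0$, with $k$ relatively prime to $p$, and let $\lambda_1,\ldots,\lambda_{n-2}\in K\setminus\{0,1\}$ be pairwise different. Then there is a sub-collection of cardinality $n+1$ of the standard basis $\mathcal{B}^{can}$, say $\theta_1,\ldots,\theta_{n+1}$, such that the map $$\widehat{\iota}_{\mathcal{B}^{can}}:C^k_{\lambda_1,\ldots,\lambda_{n-2}}\hookrightarrow\mathbb{P}^n_K,\qquad [x_1:\cdots:x_{n+1}]\mapsto[\theta_1:\cdots:\theta_{n+1}]$$ is the identity map (i.e. the inclusion $C^k_{\lambda_1,\ldots,\lambda_{n-2}}\subset\mathbb{P}^n_K$).
   Context: $C^k_{\lambda_1,\ldots,\lambda_{n-2}}\subset\mathbb{P}^n_K$ is the non-singular irreducible projective curve with equations $$x_1^k+x_2^k+x_3^k=0,\quad \lambda_1x_1^k+x_2^k+x_4^k=0,\ \ldots,\ \lambda_{n-2}x_1^k+x_2^k+x_{n+1}^k=0$$ (for $n=2$ it is the Fermat curve $x_1^k+x_2^k+x_3^k=0$). On it set $y_j=x_j/x_1$ for $j=2,\ldots,n+1$ and $z=y_2$. For integers $r$ and $\alpha_3,\ldots,\alpha_{n+1}\in\{0,1,\ldots,k-1\}$ put $\theta_{r;\alpha_3,\ldots,\alpha_{n+1}}=\dfrac{z^r\,dz}{y_3^{\alpha_3}\cdots y_{n+1}^{\alpha_{n+1}}}$. The standard basis $\mathcal{B}^{can}$ of the space of holomorphic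 (everywhere regular) one-forms on $C^k_{\lambda_1,\ldots,\lambda_{n-2}}$ is the collection of all $\theta_{r;\alpha_3,\ldots,\alpha_{n+1}}$ with $\alpha_j\in\{0,\ldots,k-1\}$ and $0\le r\le\alpha_3+\cdots+\alpha_{n+1}-2$. The map $[\theta_1:\cdots:\theta_{n+1}]$ is the map to projective space defined, as usual, by the ratios of the one-forms $\theta_i$ (the rational functions $\theta_i/\theta_j$), extended to a morphism on the whole non-singular curve. *)

theory Defs
  imports
    "HOL-Computational_Algebra.Polynomial"
    "HOL-Library.Poly_Mapping"
    "HOL-Algebra.AbelCoset"
    "HOL-Algebra.Module"
begin

section \<open>Projective space and its homogeneous polynomials\<close>

text \<open>
  The homogeneous coordinates of the projective space of dimension \<open>n\<close> are indexed by
  \<open>{1..n+1}\<close>.  Coordinate vectors are extensional functions on that set, and a point is the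
  set of all its coordinate vectors.
\<close>

definition nonzero_vecs :: "nat \<Rightarrow> (nat \<Rightarrow> 'a::field) set" where
  "nonzero_vecs n = {x \<in> {1..n+1} \<rightarrow>\<^sub>E UNIV. \<exists>i\<in>{1..n+1}. x i \<noteq> 0}"

definition proj_rel :: "nat \<Rightarrow> ((nat \<Rightarrow> 'a::field) \<times> (nat \<Rightarrow> 'a)) set" where
  "proj_rel n = {(x, y). x \<in> nonzero_vecs n \<and> y \<in> nonzero_vecs n \<and>
     (\<exists>c. c \<noteq> 0 \<and> (\<forall>i\<in>{1..n+1}. y i = c * x i))}"

definition proj_space :: "nat \<Rightarrow> (nat \<Rightarrow> 'a::field) set set" where
  "proj_space n = nonzero_vecs n // proj_rel n"

definition proj_point :: "nat \<Rightarrow> (nat \<Rightarrow> 'a::field) \<Rightarrow> (nat \<Rightarrow> 'a) set" where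
  "proj_point n x = proj_rel n `` {restrict x {1..n+1}}"

text \<open>
  A polynomial is a finitely supported map from monomials to coefficients, a monomial a finitely
  supported map from variable indices to exponents; ring operations are those of the library.
\<close>

type_synonym 'a mpoly = "(nat \<Rightarrow>\<^sub>0 nat) \<Rightarrow>\<^sub>0 'a"

definition mvar :: "nat \<Rightarrow> 'a::comm_ring_1 mpoly" where
  "mvar i = Poly_Mapping.single (Poly_Mapping.single i 1) 1"

definition mconst :: "'a::comm_ring_1 \<Rightarrow> 'a mpoly" where
  "mconst c = Poly_Mapping.single 0 c"

definition meval :: "'a::comm_ring_1 mpoly \<Rightarrow> (nat \<Rightarrow> 'a) \<Rightarrow> 'a" where
  "meval F x = 
     (\<Sum>m\<in>Poly_Mapping.keys F. Poly_Mapping.lookup F m *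
        (\<Prod>i\<in>Poly_Mapping.keys m. x i ^ Poly_Mapping.lookup m i))"

definition homogeneous :: "nat \<Rightarrow> nat \<Rightarrow> 'a::comm_ring_1 mpoly \<Rightarrow> bool" where
  "homogeneous n d F \<longleftrightarrow>
     (\<forall>m\<in>Poly_Mapping.keys F. Poly_Mapping.keys m \<subseteq> {1..n+1} \<and>
        (\<Sum>i\<in>Poly_Mapping.keys m. Poly_Mapping.lookup m i) = d)"

definition vanishes_on :: "(nat \<Rightarrow> 'a::field) set set \<Rightarrow> 'a mpoly \<Rightarrow> bool" where
  "vanishes_on C F \<longleftrightarrow> (\<forall>P\<in>C. \<forall>x\<in>P. meval F x = 0)"

section \<open>Rational functions\<close>

text \<open>
  For an irreducible closed subset \<open>C\<close> of projective space, the function field consists of the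
  fractions of homogeneous polynomials of equal degree with denominator not vanishing
  identically on \<open>C\<close>, two fractions being equal if their cross difference vanishes on \<open>C\<close>.
\<close>

type_synonym 'a ratfun = "('a mpoly \<times> 'a mpoly) set"

definition rat_pairs :: "nat \<Rightarrow> (nat \<Rightarrow> 'a::field) set set \<Rightarrow> ('a mpoly \<times> 'a mpoly) set" where
  "rat_pairs n C =
     {(F, G). (\<exists>d. homogeneous n d F \<and> homogeneous n d G) \<and> \<not> vanishes_on C G}"

definition rat_rel ::
  "nat \<Rightarrow> (nat \<Rightarrow> 'a::field) set set \<Rightarrow> (('a mpoly \<times> 'a mpoly) \<times> ('a mpoly \<times> 'a mpoly)) set" where
  "rat_rel n C = {((F, G), (F', G')).
     (F, G) \<in> rat_pairs n C \<and> (F', G') \<in> rat_pairs n C \<and> vanishes_on C (F * G' - F' * G)}"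

definition rat_frac :: "nat \<Rightarrow> (nat \<Rightarrow> 'a::field) set set \<Rightarrow> 'a mpoly \<Rightarrow> 'a mpoly \<Rightarrow> 'a ratfun" where
  "rat_frac n C F G = rat_rel n C `` {(F, G)}"

definition function_field :: "nat \<Rightarrow> (nat \<Rightarrow> 'a::field) set set \<Rightarrow> 'a ratfun ring" where
  "function_field n C =
     \<lparr>carrier = rat_pairs n C // rat_rel n C,
      mult = (\<lambda>f g. \<Union>(F, G)\<in>f. \<Union>(F', G')\<in>g. rat_frac n C (F * F') (G * G')),
      one = rat_frac n C 1 1,
      zero = rat_frac n C 0 1,
      add = (\<lambda>f g. \<Union>(F, G)\<in>f. \<Union>(F', G')\<in>g. rat_frac n C (F * G' + F' * G) (G * G'))\<rparr>"

definition constant_field :: "nat \<Rightarrow> (nat \<Rightarrow> 'a::field) set set \<Rightarrow> 'a ratfun set" where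
  "constant_field n C = range (\<lambda>c. rat_frac n C (mconst c) 1)"

definition regular_at :: "'a::field ratfun \<Rightarrow> (nat \<Rightarrow> 'a) set \<Rightarrow> bool" where
  "regular_at f P \<longleftrightarrow> (\<exists>(F, G)\<in>f. \<exists>x\<in>P. meval G x \<noteq> 0)"

definition value_at :: "'a::field ratfun \<Rightarrow> (nat \<Rightarrow> 'a) set \<Rightarrow> 'a" where
  "value_at f P = (THE v. \<exists>(F, G)\<in>f. \<exists>x\<in>P. meval G x \<noteq> 0 \<and> v = meval F x / meval G x)"

section \<open>One-forms\<close>

text \<open>
  The module of Kaehler differentials of a commutative ring \<open>R\<close> over a subring \<open>k\<close>: the free
  \<open>R\<close>-module on symbols indexed by the elements of \<open>R\<close>, modulo additivity, the Leibniz rule and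
  the vanishing on \<open>k\<close>.  The fields \<open>mult\<close> and \<open>one\<close>, which the module record inherits from the
  ring record, are not used.
\<close>

definition free_module :: "('r, 'b) ring_scheme \<Rightarrow> ('r, 'r \<Rightarrow> 'r) module" where
  "free_module R =
     \<lparr>carrier = {u \<in> carrier R \<rightarrow>\<^sub>E carrier R. finite {g \<in> carrier R. u g \<noteq> \<zero>\<^bsub>R\<^esub>}},
      mult = undefined,
      one = undefined,
      zero = (\<lambda>g\<in>carrier R. \<zero>\<^bsub>R\<^esub>),
      add = (\<lambda>u v. \<lambda>g\<in>carrier R. u g \<oplus>\<^bsub>R\<^esub> v g),
      smult = (\<lambda>a u. \<lambda>g\<in>carrier R. a \<otimes>\<^bsub>R\<^esub> u g)\<rparr>"

definition free_gen :: "('r, 'b) ring_scheme \<Rightarrow> 'r \<Rightarrow> 'r \<Rightarrow> 'r" where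
  "free_gen R a = (\<lambda>g\<in>carrier R. if g = a then \<one>\<^bsub>R\<^esub> else \<zero>\<^bsub>R\<^esub>)"

definition kaehler_gens :: "('r, 'b) ring_scheme \<Rightarrow> 'r set \<Rightarrow> ('r \<Rightarrow> 'r) set" where
  "kaehler_gens R k =
     (let M = free_module R; \<delta> = free_gen R in
       {\<delta> (a \<oplus>\<^bsub>R\<^esub> b) \<ominus>\<^bsub>M\<^esub> (\<delta> a \<oplus>\<^bsub>M\<^esub> \<delta> b) | a b. a \<in> carrier R \<and> b \<in> carrier R} \<union>
       {\<delta> (a \<otimes>\<^bsub>R\<^esub> b) \<ominus>\<^bsub>M\<^esub> (a \<odot>\<^bsub>M\<^esub> \<delta> b \<oplus>\<^bsub>M\<^esub> b \<odot>\<^bsub>M\<^esub> \<delta> a) | a b. a \<in> carrier R \<and> b \<in> carrier R} \<union>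
       \<delta> ` k)"

definition kaehler_rels :: "('r, 'b) ring_scheme \<Rightarrow> 'r set \<Rightarrow> ('r \<Rightarrow> 'r) set" where
  "kaehler_rels R k = (\<lambda>N. submodule N R (free_module R)) hull kaehler_gens R k"

definition kaehler :: "('r, 'b) ring_scheme \<Rightarrow> 'r set \<Rightarrow> ('r, ('r \<Rightarrow> 'r) set) module" where
  "kaehler R k =
     (let M = free_module R; N = kaehler_rels R k in
       \<lparr>carrier = a_rcosets\<^bsub>M\<^esub> N,
        mult = undefined,
        one = undefined,
        zero = N,
        add = (\<lambda>X Y. X <+>\<^bsub>M\<^esub> Y),
        smult = (\<lambda>a X. \<Union>u\<in>X. N +>\<^bsub>M\<^esub> (a \<odot>\<^bsub>M\<^esub> u))\<rparr>)"

definition kaehler_d :: "('r, 'b) ring_scheme \<Rightarrow> 'r set \<Rightarrow> 'r \<Rightarrow> ('r \<Rightarrow> 'r) set" where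
  "kaehler_d R k f = kaehler_rels R k +>\<^bsub>free_module R\<^esub> free_gen R f"

type_synonym 'a one_form = "('a ratfun \<Rightarrow> 'a ratfun) set"

definition one_forms ::
  "nat \<Rightarrow> (nat \<Rightarrow> 'a::field) set set \<Rightarrow> ('a ratfun, 'a one_form) module" where
  "one_forms n C = kaehler (function_field n C) (constant_field n C)"

definition dform :: "nat \<Rightarrow> (nat \<Rightarrow> 'a::field) set set \<Rightarrow> 'a ratfun \<Rightarrow> 'a one_form" where
  "dform n C f = kaehler_d (function_field n C) (constant_field n C) f"

text \<open>
  On a curve the one-forms are a one-dimensional space over the function field, so the ratio is
  well-defined for nonzero \<open>\<eta>\<close>.
\<close>

definition form_ratio ::
  "nat \<Rightarrow> (nat \<Rightarrow> 'a::field) set set \<Rightarrow> 'a one_form \<Rightarrow> 'a one_form \<Rightarrow> 'a ratfun" where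
  "form_ratio n C \<omega> \<eta> =
     (THE f. f \<in> carrier (function_field n C) \<and> \<omega> = f \<odot>\<^bsub>one_forms n C\<^esub> \<eta>)"

section \<open>The map to projective space defined by one-forms\<close>

text \<open>
  A morphism is locally, on open sets cut out by \<open>H \<noteq> 0\<close>, given by homogeneous polynomials of
  equal degree without common zero there.
\<close>

definition morphism ::
  "nat \<Rightarrow> (nat \<Rightarrow> 'a::field) set set \<Rightarrow> nat \<Rightarrow> ((nat \<Rightarrow> 'a) set \<Rightarrow> (nat \<Rightarrow> 'a) set) \<Rightarrow> bool" where
  "morphism n C m \<phi> \<longleftrightarrow>
     \<phi> \<in> C \<rightarrow>\<^sub>E proj_space m \<and>
     (\<forall>P\<in>C. \<exists>d e H F.
        homogeneous n e H \<and> (\<forall>i\<in>{1..m+1}. homogeneous n d (F i)) \<and>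
        (\<forall>x\<in>P. meval H x \<noteq> 0) \<and>
        (\<forall>Q\<in>C. \<forall>x\<in>Q. meval H x \<noteq> 0 \<longrightarrow>
           (\<exists>i\<in>{1..m+1}. meval (F i) x \<noteq> 0) \<and>
           \<phi> Q = proj_point m (\<lambda>i. meval (F i) x)))"

text \<open>
  \<open>map_of_forms n C m \<theta> \<phi>\<close>: the function \<open>\<phi>\<close> is the map
  \<open>[\<theta> 1 : \<dots> : \<theta> (m + 1)]\<close> from \<open>C\<close> to the projective space of dimension \<open>m\<close>, that is, a morphism
  defined on all of \<open>C\<close> which extends the rational map given by the ratios of the one-forms.
\<close>

definition map_of_forms ::
  "nat \<Rightarrow> (nat \<Rightarrow> 'a::field) set set \<Rightarrow> nat \<Rightarrow> (nat \<Rightarrow> 'a one_form) \<Rightarrow>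
   ((nat \<Rightarrow> 'a) set \<Rightarrow> (nat \<Rightarrow> 'a) set) \<Rightarrow> bool" where
  "map_of_forms n C m \<theta> \<phi> \<longleftrightarrow>
     morphism n C m \<phi> \<and>
     (\<exists>j\<in>{1..m+1}. \<theta> j \<noteq> \<zero>\<^bsub>one_forms n C\<^esub>) \<and>
     (\<forall>j\<in>{1..m+1}. \<theta> j \<noteq> \<zero>\<^bsub>one_forms n C\<^esub> \<longrightarrow>
        (\<forall>P\<in>C. (\<forall>i\<in>{1..m+1}. regular_at (form_ratio n C (\<theta> i) (\<theta> j)) P) \<longrightarrow>
           \<phi> P = proj_point m (\<lambda>i. value_at (form_ratio n C (\<theta> i) (\<theta> j)) P)))"

section \<open>Generalized Fermat curves and their standard one-forms\<close>

definition gf_curve :: "nat \<Rightarrow> nat \<Rightarrow> (nat \<Rightarrow> 'a::field) \<Rightarrow> (nat \<Rightarrow> 'a) set set" where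
  "gf_curve k n lam = {P \<in> proj_space n. \<forall>x\<in>P.
     x 1 ^ k + x 2 ^ k + x 3 ^ k = 0 \<and>
     (\<forall>i\<in>{1..n-2}. lam i * x 1 ^ k + x 2 ^ k + x (i + 3) ^ k = 0)}"

definition gf_coord :: "nat \<Rightarrow> nat \<Rightarrow> (nat \<Rightarrow> 'a::field) \<Rightarrow> nat \<Rightarrow> 'a ratfun" where
  "gf_coord k n lam j = rat_frac n (gf_curve k n lam) (mvar j) (mvar 1)"

definition gf_form ::
  "nat \<Rightarrow> nat \<Rightarrow> (nat \<Rightarrow> 'a::field) \<Rightarrow> nat \<Rightarrow> (nat \<Rightarrow> nat) \<Rightarrow> 'a one_form" where
  "gf_form k n lam r \<alpha> =
     (let C = gf_curve k n lam; L = function_field n C; y = gf_coord k n lam; z = y 2 in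
       (z [^]\<^bsub>L\<^esub> r \<otimes>\<^bsub>L\<^esub> inv\<^bsub>L\<^esub> (\<Otimes>\<^bsub>L\<^esub>j\<in>{3..n+1}. y j [^]\<^bsub>L\<^esub> \<alpha> j)) \<odot>\<^bsub>one_forms n C\<^esub> dform n C z)"

definition standard_basis :: "nat \<Rightarrow> nat \<Rightarrow> (nat \<Rightarrow> 'a::field) \<Rightarrow> 'a one_form set" where
  "standard_basis k n lam =
     {gf_form k n lam r \<alpha> | r \<alpha>.
        (\<forall>j\<in>{3..n+1}. \<alpha> j \<in> {0..k-1}) \<and> int r \<le> (\<Sum>j=3..n+1. int (\<alpha> j)) - 2}"

end

theory Submission
  imports
    "HOL-Number_Theory.Residues"
    "HOL-Computational_Algebra.Polynomial_FPS"
    "HOL-Computational_Algebra.Formal_Laurent_Series"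
    Defs
begin

text \<open>
  Write \<open>y\<^sub>j = x\<^sub>j / x\<^sub>1\<close> and \<open>z = y\<^sub>2\<close>.  Raising the exponent of \<open>z\<close> by one multiplies a form
  \<open>z\<^sup>r dz / \<Prod> y\<^sub>j\<^bsup>\<alpha>\<^sub>j\<^esup>\<close> by \<open>z\<close>, and lowering \<open>\<alpha>\<^sub>j\<close> by one multiplies it by \<open>y\<^sub>j\<close>.  Start with
  \<open>\<theta>\<^sub>1 = dz / \<Prod> y\<^sub>j\<^bsup>k-1\<^esup>\<close>, in which all exponents are as large as the standard basis permits.  Then
  \<open>\<theta>\<^sub>2 = z \<theta>\<^sub>1\<close> and \<open>\<theta>\<^sub>j = y\<^sub>j \<theta>\<^sub>1\<close> are forms of the same shape, and all of them lie in the standard basis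
  because \<open>(k - 1) (n - 1) \<ge> 3\<close>.  The ratio \<open>\<theta>\<^sub>i / \<theta>\<^sub>j\<close> is the rational function \<open>x\<^sub>i / x\<^sub>j\<close>.
  
  These ratios determine the map.  Where \<open>x\<^sub>j \<noteq> 0\<close>, all \<open>x\<^sub>i / x\<^sub>j\<close> are regular and have the expected
  values.  Conversely, if \<open>x\<^sub>i / x\<^sub>j\<close> is regular at a point with value \<open>v\<^sub>i\<close>, then
  \<open>x\<^sub>i = v\<^sub>i x\<^sub>j\<close> there, so if this holds for all \<open>i\<close> then \<open>x\<^sub>j \<noteq> 0\<close> because some \<open>x\<^sub>i\<close> is nonzero
  (\<open>map_of_forms_iff_identity\<close>).
  
  It remains to know that the fractions form a field, which amounts to irreducibility of the curve,
  and that \<open>f dz\<close> determines \<open>f\<close>.  Both come from one power series point.  Over \<open>z = 0\<close> the projection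
  to \<open>z\<close> is unramified, so there are \<open>y\<^sub>j \<in> K[[t]]\<close> with \<open>y\<^sub>j\<^sup>k = - (\<mu>\<^sub>j + t\<^sup>k)\<close>, where \<open>\<mu>\<^sub>3 = 1\<close> and
  \<open>\<mu>\<^sub>j = \<lambda>\<^bsub>j-3\<^esub>\<close> for \<open>j > 3\<close>; put
  \<open>u = (1, t, y\<^sub>3, \<dots>, y\<^bsub>n+1\<^esub>)\<close>.  The main step is \<open>vanishes_on_iff_generic\<close>: a homogeneous polynomial \<open>F\<close>
  vanishes on the curve if and only if \<open>F(u) = 0\<close>.  As \<open>K[[t]]\<close> is a domain, the function field therefore
  embeds into \<open>K((t))\<close>, and \<open>d/dt\<close> is a derivation taking \<open>z\<close> to \<open>1\<close>.  This
  derivation induces a linear functional on the Kaehler differentials that recovers \<open>f\<close> from \<open>f dz\<close>.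
  
  For the main step, use the equations of the curve to lower all exponents of \<open>x\<^sub>3, \<dots>, x\<^bsub>n+1\<^esub>\<close> below
  \<open>k\<close>, without changing the degree or the values on the cone.  A reduced polynomial becomes
  \<open>\<Sum>\<^sub>\<alpha> c\<^sub>\<alpha>(z) y\<^sup>\<alpha>\<close> for \<open>x\<^sub>1 = 1\<close>.  If it vanishes on the curve, then it vanishes, over almost every \<open>z\<close>, on a grid
  of \<open>k\<close> values for each \<open>y\<^sub>j\<close>, and all \<open>c\<^sub>\<alpha>\<close> are zero (\<open>coeffs_zero_if_vanishes_on_grid\<close>).  If it
  vanishes at \<open>u\<close>, then all \<open>c\<^sub>\<alpha>\<close> are zero because the monomials \<open>y\<^sup>\<alpha>\<close> in the radicals are
  linearly independent over \<open>K[t]\<close> (\<open>radicals_independent\<close>).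
\<close>

section \<open>Roots of power series\<close>

text \<open>
  As \<open>k\<close> is invertible, \<open>(1 + X)\<^sup>k - 1\<close> has a compositional inverse, which gives a \<open>k\<close>-th root of \<open>1 + X\<close>.
  Substituting \<open>u / u(0) - 1\<close> for \<open>X\<close> yields a root of \<open>u / u(0)\<close> in any characteristic prime to \<open>k\<close>.
\<close>

lemma fps_nth_root_exists:
  fixes u :: "'a::alg_closed_field fps"
  assumes "k > 0" "of_nat k \<noteq> (0::'a)" "u $ 0 \<noteq> 0"
  obtains v where "v ^ k = u"
proof -
  define f :: "'a fps" where "f = (1 + fps_X) ^ k - 1"
  have f0: "f $ 0 = 0"
    by (simp add: f_def fps_power_zeroth)
  have "fps_deriv f $ 0 = of_nat k"
    by (simp add: f_def fps_deriv_power fps_power_zeroth)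
  hence f1: "f $ 1 \<noteq> 0"
    using assms(2) by simp
  define w where "w = fps_const (inverse (u $ 0)) * u - 1"
  have w0: "w $ 0 = 0"
    using assms(3) by (simp add: w_def)
  have "(fps_inv f) $ 0 = 0"
    by (simp add: fps_inv_def)
  hence "(1 + fps_inv f) ^ k - 1 = f oo fps_inv f"
    by (simp add: f_def fps_compose_sub_distrib fps_compose_add_distrib flip: fps_compose_power)
  also have "\<dots> = fps_X"
    using f0 f1 by (rule fps_inv_right)
  finally have "(1 + fps_inv f) ^ k = 1 + fps_X"
    by (simp add: algebra_simps)
  hence "((1 + fps_inv f) oo w) ^ k = (1 + fps_X) oo w"
    using w0 by (metis fps_compose_power)
  also have "\<dots> = fps_const (inverse (u $ 0)) * u"
    using w0 by (simp add: fps_compose_add_distrib w_def)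
  finally have 1: "((1 + fps_inv f) oo w) ^ k = fps_const (inverse (u $ 0)) * u" .
  obtain c where c: "c ^ k = u $ 0"
    using nth_root_exists[OF assms(1)] by blast
  have "(fps_const c * ((1 + fps_inv f) oo w)) ^ k = fps_const (u $ 0) * (fps_const (inverse (u $ 0)) * u)"
    by (simp add: power_mult_distrib 1 c fps_const_power)
  also have "\<dots> = u"
    using assms(3) by (simp flip: mult.assoc)
  finally show ?thesis by (rule that)
qed

section \<open>Linear independence of products of radicals\<close>

text \<open>
  The argument for the independence of eigenvectors with distinct eigenvalues, for an operator \<open>T\<close> that is
  only additive: it maps each line \<open>E w\<^sub>i\<close> into itself.  Combining a relation with its image
  under \<open>T\<close> cancels one term, and the hypothesis \<open>distinct\<close>, which says that \<open>T v / v\<close> differs between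
  nonzero multiples \<open>v\<close> of \<open>w\<^sub>i\<close> and of \<open>w\<^sub>j\<close>, keeps the other terms from cancelling.
\<close>

lemma semilinear_independence:
  fixes w :: "'i \<Rightarrow> 'b::idom" and T :: "'b \<Rightarrow> 'b"
  assumes T_add: "\<And>a b. T (a + b) = T a + T b"
    and E_diff: "\<And>a b. a \<in> E \<Longrightarrow> b \<in> E \<Longrightarrow> a - b \<in> E"
    and E_mult: "\<And>a b. a \<in> E \<Longrightarrow> b \<in> E \<Longrightarrow> a * b \<in> E"
    and eigen: "\<And>i c. i \<in> J \<Longrightarrow> c \<in> E \<Longrightarrow> \<exists>e\<in>E. T (c * w i) = e * w i"
    and nonzero: "\<And>i. i \<in> J \<Longrightarrow> w i \<noteq> 0"
    and distinct: "\<And>i j c d. \<lbrakk>i \<in> J; j \<in> J; c \<in> E; d \<in> E; c \<noteq> 0; d \<noteq> 0;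
      T (c * w i) * (d * w j) = T (d * w j) * (c * w i)\<rbrakk> \<Longrightarrow> i = j"
    and "finite J" and "\<And>i. i \<in> J \<Longrightarrow> c i \<in> E" and "(\<Sum>i\<in>J. c i * w i) = 0" and "i \<in> J"
  shows "c i = 0"
proof -
  have "T 0 + T 0 = T 0 + 0"
    using T_add[of 0 0] by simp
  hence T0: "T 0 = 0"
    by (simp only: add_left_cancel)
  have T_sum: "T (sum f F) = (\<Sum>i\<in>F. T (f i))" if "finite F" for f :: "'i \<Rightarrow> 'b" and F
    using that T0 by (induction F) (auto simp: T_add)
  have "\<forall>i\<in>F. c i = 0"
    if "finite F" "F \<subseteq> J" "\<forall>i\<in>F. c i \<in> E" "(\<Sum>i\<in>F. c i * w i) = 0" for F and c :: "'i \<Rightarrow> 'b"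
    using that
  proof (induction F arbitrary: c rule: finite_induct)
    case (insert j F)
    show ?case
    proof (cases "c j = 0")
      case True
      thus ?thesis using insert by auto
    next
      case False
      have "\<forall>i\<in>insert j F. \<exists>e. e \<in> E \<and> T (c i * w i) = e * w i"
        using eigen insert.prems by blast
      then obtain \<tau> where \<tau>: "\<And>i. i \<in> insert j F \<Longrightarrow> \<tau> i \<in> E \<and> T (c i * w i) = \<tau> i * w i"
        using bchoice[of "insert j F" "\<lambda>i e. e \<in> E \<and> T (c i * w i) = e * w i"] by blast
      have "0 = T 0"
        by (simp add: T0)
      also have "\<dots> = (\<Sum>i\<in>insert j F. \<tau> i * w i)"
        using T_sum[of "insert j F" "\<lambda>i. c i * w i"] insert.hyps \<tau> insert.prems by simp
      finally have rel: "(\<Sum>i\<in>insert j F. \<tau> i * w i) = 0" ..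
      \<comment> \<open>the combination in which the term of \<open>j\<close> cancels\<close>
      define d where "d i = \<tau> i * c j - \<tau> j * c i" for i
      have "(\<Sum>i\<in>insert j F. d i * w i)
          = c j * (\<Sum>i\<in>insert j F. \<tau> i * w i) - \<tau> j * (\<Sum>i\<in>insert j F. c i * w i)"
        unfolding d_def sum_distrib_left sum_subtractf[symmetric]
        by (rule sum.cong) (auto simp: algebra_simps)
      also have "\<dots> = 0"
        using rel insert.prems by simp
      finally have "(\<Sum>i\<in>F. d i * w i) = 0"
        using insert.hyps by (simp add: d_def)
      moreover have "\<forall>i\<in>F. d i \<in> E"
        using \<tau> insert.prems by (auto simp: d_def intro!: E_diff E_mult)
      ultimately have d0: "\<forall>i\<in>F. d i = 0"
        using insert.IH[of d] insert.prems by blast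
      have "c i = 0" if "i \<in> F" for i
      proof (rule ccontr)
        assume "c i \<noteq> 0"
        have "T (c i * w i) * (c j * w j) = (\<tau> i * c j) * (w i * w j)"
          using \<tau>[of i] that by simp
        also have "\<dots> = (\<tau> j * c i) * (w i * w j)"
          using d0 that by (simp add: d_def)
        also have "\<dots> = T (c j * w j) * (c i * w i)"
          using \<tau>[of j] by simp
        finally have "i = j"
          using insert.prems that False \<open>c i \<noteq> 0\<close> by (intro distinct) auto
        thus False using insert.hyps that by blast
      qed
      hence "c j * w j = 0"
        using insert by simp
      thus ?thesis using nonzero[of j] False insert.prems by auto
    qed
  qed auto
  from this[of J c] show ?thesis using assms by blast
qed

lemma order_power_times_prod:
  fixes c :: "'a::field poly"
  assumes "finite S" "c \<noteq> 0" "\<And>i. i \<in> S \<Longrightarrow> a i \<noteq> 0"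
    and "j \<in> S" "Polynomial.order x (a j) = 1" "\<And>i. i \<in> S \<Longrightarrow> i \<noteq> j \<Longrightarrow> Polynomial.order x (a i) = 0"
  shows "Polynomial.order x (c ^ k * (\<Prod>i\<in>S. a i ^ \<alpha> i)) = k * Polynomial.order x c + \<alpha> j"
proof -
  have pow: "Polynomial.order x (p ^ m) = m * Polynomial.order x p" if "p \<noteq> 0" for p :: "'a poly" and m
    using that by (induction m) (auto simp: order_mult)
  have "(\<Prod>i\<in>S. a i ^ \<alpha> i) \<noteq> 0"
    using assms by auto
  moreover have "Polynomial.order x (\<Prod>i\<in>F. a i ^ \<alpha> i) = (\<Sum>i\<in>F. \<alpha> i * Polynomial.order x (a i))" if "F \<subseteq> S" for F
    using finite_subset[OF that assms(1)] that
  proof (induction F)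
    case (insert i F)
    moreover have "(\<Prod>i\<in>F. a i ^ \<alpha> i) \<noteq> 0" "a i \<noteq> 0"
      using assms insert by auto
    ultimately show ?case
      by (simp add: order_mult pow)
  qed auto
  moreover have "(\<Sum>i\<in>S. \<alpha> i * Polynomial.order x (a i)) = \<alpha> j"
    using assms by (subst sum.remove[OF assms(1,4)]) (auto intro!: sum.neutral)
  ultimately show ?thesis
    using assms by (simp add: order_mult pow)
qed

text \<open>
  If \<open>p\<close> and \<open>q\<close> have orders \<open>r\<close> and \<open>s\<close> at \<open>x\<close>, then the coefficient of \<open>(X - x)\<^bsup>r+s-1\<^esup>\<close> in
  \<open>p' q - q' p\<close> is \<open>r - s\<close> times a nonzero constant.
\<close>

lemma order_eq_if_wronskian_zero:
  fixes p q :: "'a::field poly"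
  assumes char: "CHAR('a) = 0" and "p \<noteq> 0" "q \<noteq> 0" and wr: "pderiv p * q = pderiv q * p"
  shows "Polynomial.order x p = Polynomial.order x q"
proof -
  obtain p1 where p: "p = [:-x, 1:] ^ Polynomial.order x p * p1" "\<not> [:-x, 1:] dvd p1"
    using order_decomp[OF assms(2)] by blast
  obtain q1 where q: "q = [:-x, 1:] ^ Polynomial.order x q * q1" "\<not> [:-x, 1:] dvd q1"
    using order_decomp[OF assms(3)] by blast
  define l where "l = [:-x, 1:]"
  have l: "l \<noteq> 0" "pderiv l = 1" "poly l x = 0"
    by (auto simp: l_def pderiv_pCons)
  define r s where "r = Polynomial.order x p" and "s = Polynomial.order x q"
  have dpow: "l * pderiv (l ^ m) = of_nat m * l ^ m" for m
    using l by (cases m) (auto simp: pderiv_power_Suc of_nat_poly simp del: of_nat_Suc power_Suc, simp)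
  have "l * (pderiv p * q) = l ^ (r + s) * ((of_nat r * p1 + l * pderiv p1) * q1)"
  proof -
    have "l * (pderiv p * q) = (l * pderiv (l ^ r) * p1 + l ^ r * l * pderiv p1) * (l ^ s * q1)"
      by (subst p(1), subst q(1)) (simp add: l_def r_def s_def pderiv_mult algebra_simps)
    thus ?thesis unfolding dpow by (simp add: algebra_simps power_add)
  qed
  moreover have "l * (pderiv q * p) = l ^ (r + s) * ((of_nat s * q1 + l * pderiv q1) * p1)"
  proof -
    have "l * (pderiv q * p) = (l * pderiv (l ^ s) * q1 + l ^ s * l * pderiv q1) * (l ^ r * p1)"
      by (subst p(1), subst q(1)) (simp add: l_def r_def s_def pderiv_mult algebra_simps)
    thus ?thesis unfolding dpow by (simp add: algebra_simps power_add)
  qed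
  ultimately have "(of_nat r * p1 + l * pderiv p1) * q1 = (of_nat s * q1 + l * pderiv q1) * p1"
    using wr l by (metis mult_cancel_left power_not_zero)
  hence "poly ((of_nat r * p1 + l * pderiv p1) * q1) x = poly ((of_nat s * q1 + l * pderiv q1) * p1) x"
    by simp
  hence "(of_nat r :: 'a) * (poly p1 x * poly q1 x) = of_nat s * (poly p1 x * poly q1 x)"
    using l by (simp add: algebra_simps)
  moreover have "poly p1 x \<noteq> 0" "poly q1 x \<noteq> 0"
    using p q by (auto simp: poly_eq_0_iff_dvd)
  ultimately have "(of_nat r :: 'a) = of_nat s"
    by simp
  hence "r = s"
    using char by (simp add: of_nat_eq_iff_cong_CHAR)
  thus ?thesis by (simp add: r_def s_def)
qed

lemma wronskian_power:
  fixes u v :: "'a::idom fps"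
  assumes "fps_deriv u * v = fps_deriv v * u" "k > 0"
  shows "fps_deriv (u ^ k) * v ^ k = fps_deriv (v ^ k) * u ^ k"
proof -
  have deriv: "fps_deriv (f ^ k) = of_nat k * f ^ (k - 1) * fps_deriv f" for f :: "'a fps"
    by (simp add: fps_deriv_power fps_of_nat mult_ac)
  have power: "f ^ k = f ^ (k - 1) * f" for f :: "'a fps"
    using assms(2) by (metis power_minus_mult)
  have "fps_deriv (u ^ k) * v ^ k = of_nat k * u ^ (k - 1) * v ^ (k - 1) * (fps_deriv u * v)"
    unfolding deriv power[of v] by (simp only: mult_ac)
  also have "\<dots> = of_nat k * u ^ (k - 1) * v ^ (k - 1) * (fps_deriv v * u)"
    by (simp only: assms(1))
  also have "\<dots> = fps_deriv (v ^ k) * u ^ k"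
    unfolding deriv power[of u] by (simp only: mult_ac)
  finally show ?thesis .
qed

text \<open>
  The \<open>k\<close>-th power of \<open>c y\<^sup>\<alpha>\<close> is the polynomial \<open>c\<^sup>k \<Prod> a\<^sub>j\<^bsup>\<alpha>\<^sub>j\<^esup>\<close>, whose order at \<open>b\<^sub>j\<close> is congruent to
  \<open>\<alpha>\<^sub>j\<close> modulo \<open>k\<close>; so the orders of this polynomial determine \<open>\<alpha>\<close>.  What is needed is an additive operator for
  \<open>semilinear_independence\<close> such that \<open>T v / v\<close> determines these orders.
  
  In characteristic zero, \<open>T\<close> is \<open>d/dt\<close>, multiplied by \<open>\<Prod> a\<^sub>j\<close> to clear denominators: equal logarithmic
  derivatives of two series give a vanishing Wronskian of their \<open>k\<close>-th powers, hence equal orders.  In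
  characteristic \<open>p\<close> logarithmic derivatives see the orders only modulo \<open>p\<close>.  There \<open>T v = v\<^sup>q\<close>, where
  \<open>q\<close> is a power of \<open>p\<close> that is congruent to 1 modulo \<open>k\<close>: then \<open>T v / v = v\<^bsup>q-1\<^esup>\<close> is a power of \<open>v\<^sup>k\<close>, and equality gives
  equal orders as well.
\<close>

theorem radicals_independent:
  fixes y :: "'i \<Rightarrow> 'a::field fps" and a :: "'i \<Rightarrow> 'a poly" and c :: "('i \<Rightarrow> nat) \<Rightarrow> 'a poly"
  assumes "finite S" and "k > 0" and char: "coprime k CHAR('a) \<or> CHAR('a) = 0"
    and root: "\<And>j. j \<in> S \<Longrightarrow> y j ^ k = fps_of_poly (a j)"
    and nz: "\<And>j. j \<in> S \<Longrightarrow> a j \<noteq> 0"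
    and simple_zero: "\<And>j. j \<in> S \<Longrightarrow> Polynomial.order (b j) (a j) = 1"
    and no_zero: "\<And>i j. i \<in> S \<Longrightarrow> j \<in> S \<Longrightarrow> i \<noteq> j \<Longrightarrow> Polynomial.order (b j) (a i) = 0"
    and rel: "(\<Sum>\<alpha>\<in>S \<rightarrow>\<^sub>E {..<k}. fps_of_poly (c \<alpha>) * (\<Prod>j\<in>S. y j ^ \<alpha> j)) = 0"
    and \<alpha>: "\<alpha> \<in> S \<rightarrow>\<^sub>E {..<k}"
  shows "c \<alpha> = 0"
proof -
  define J where "J = S \<rightarrow>\<^sub>E {..<k}"
  define E where "E = range (fps_of_poly :: 'a poly \<Rightarrow> _)"
  define w where "w \<alpha> = (\<Prod>j\<in>S. y j ^ \<alpha> j)" for \<alpha>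
  have fin: "finite J"
    using assms(1) by (auto simp: J_def intro!: finite_PiE)
  have E_diff: "p - q \<in> E" and E_mult: "p * q \<in> E" and E_add: "p + q \<in> E"
    if "p \<in> E" "q \<in> E" for p q
    using that by (auto simp: E_def simp flip: fps_of_poly_diff fps_of_poly_mult fps_of_poly_add)
  have zeroE: "0 \<in> E" and oneE: "1 \<in> E"
    unfolding E_def using fps_of_poly_0 fps_of_poly_1 by (metis rangeI)+
  have E_prod: "(\<Prod>i\<in>F. f i) \<in> E" if "\<And>i. i \<in> F \<Longrightarrow> f i \<in> E" for F :: "'i set" and f
    using that
    by (induction F rule: infinite_finite_induct)
      (auto intro: E_mult oneE)
  have E_power: "p ^ m \<in> E" if "p \<in> E" for p m
    using that by (auto simp: E_def simp flip: fps_of_poly_power)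
  have y0: "y j \<noteq> 0" if "j \<in> S" for j
  proof
    assume "y j = 0"
    hence "fps_of_poly (a j) = fps_of_poly 0"
      using root[OF that] assms(2) by (simp add: zero_power)
    thus False
      using nz[OF that] by (simp only: fps_of_poly_eq_iff)
  qed
  have w0: "w \<alpha> \<noteq> 0" for \<alpha>
    using y0 assms(1) by (auto simp: w_def)
  have kth: "(fps_of_poly p * w \<alpha>) ^ k = fps_of_poly (p ^ k * (\<Prod>j\<in>S. a j ^ \<alpha> j))" for p \<alpha>
    by (simp add: w_def power_mult_distrib fps_of_poly_mult fps_of_poly_power fps_of_poly_prod
        prod_power_distrib root mult.commute flip: power_mult)
       (simp add: power_mult root)
  have eq_if_order_eq: "\<alpha> = \<beta>"
    if ord: "\<And>x. Polynomial.order x (p ^ k * (\<Prod>j\<in>S. a j ^ \<alpha> j)) = Polynomial.order x (q ^ k * (\<Prod>j\<in>S. a j ^ \<beta> j))"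
      and "\<alpha> \<in> J" "\<beta> \<in> J" "p \<noteq> 0" "q \<noteq> 0" for p q \<alpha> \<beta>
  proof (rule PiE_ext)
    show "\<alpha> \<in> S \<rightarrow>\<^sub>E {..<k}" "\<beta> \<in> S \<rightarrow>\<^sub>E {..<k}"
      using that by (simp_all add: J_def)
    fix j assume j: "j \<in> S"
    have "k * Polynomial.order (b j) p + \<alpha> j = k * Polynomial.order (b j) q + \<beta> j"
      using ord[of "b j"] simple_zero[OF j] no_zero[OF _ j] nz that(4,5)
      by (simp add: order_power_times_prod[OF assms(1) _ _ j])
    hence "(k * Polynomial.order (b j) p + \<alpha> j) mod k = (k * Polynomial.order (b j) q + \<beta> j) mod k"
      by simp
    thus "\<alpha> j = \<beta> j"
      using that j by (auto simp: J_def PiE_iff)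
  qed
  have "fps_of_poly (c \<alpha>) = 0"
  proof (cases "CHAR('a) = 0")
    case char0: True
    define A where "A = (\<Prod>j\<in>S. y j ^ k)"
    define T where "T f = A * fps_deriv f" for f
    have A0: "A \<noteq> 0"
      using y0 assms(1) by (auto simp: A_def)
    have kE: "fps_const (inverse (of_nat k)) \<in> E"
      unfolding E_def using fps_of_poly_const by (metis rangeI)
    have k0: "(of_nat k :: 'a) \<noteq> 0"
      using char0 assms(2) by (simp add: of_nat_eq_0_iff_char_dvd)
    have y_eigen: "\<exists>e\<in>E. T (y j) = e * y j" if j: "j \<in> S" for j
    proof -
      have "fps_deriv (y j ^ k) * y j = of_nat k * fps_deriv (y j) * y j ^ k"
        using power_minus_mult[OF assms(2), of "y j"] by (simp add: fps_deriv_power fps_of_nat mult_ac)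
      hence 1: "fps_const (of_nat k) * (y j ^ k * fps_deriv (y j)) = fps_of_poly (pderiv (a j)) * y j"
        using root[OF j] by (simp add: fps_of_poly_pderiv fps_of_nat algebra_simps)
      have "y j ^ k * fps_deriv (y j)
          = fps_const (inverse (of_nat k)) * (fps_const (of_nat k) * (y j ^ k * fps_deriv (y j)))"
        using k0 by (simp flip: mult.assoc)
      hence 2: "y j ^ k * fps_deriv (y j)
          = fps_const (inverse (of_nat k)) * fps_of_poly (pderiv (a j)) * y j"
        unfolding 1 by (simp add: mult.assoc)
      have "T (y j) = (\<Prod>i\<in>S - {j}. y i ^ k) * (y j ^ k * fps_deriv (y j))"
        using j assms(1) by (simp add: T_def A_def prod.remove algebra_simps)
      also have "\<dots> = ((\<Prod>i\<in>S - {j}. y i ^ k) * (fps_const (inverse (of_nat k)) * fps_of_poly (pderiv (a j)))) * y j"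
        unfolding 2 by (simp add: algebra_simps)
      finally show ?thesis
        by (rule bexI) (auto intro!: E_mult E_prod kE simp: root, auto simp: E_def)
    qed
    have T_mult: "T (f * g) = T f * g + f * T g" for f g
      by (simp add: T_def algebra_simps)
    have eigen_mult: "\<exists>e\<in>E. T (f * g) = e * (f * g)"
      if fg: "\<exists>e\<in>E. T f = e * f" "\<exists>e\<in>E. T g = e * g" for f g
    proof -
      from fg obtain d e where "d \<in> E" "T f = d * f" "e \<in> E" "T g = e * g"
        by blast
      thus ?thesis
        by (intro bexI[of _ "d + e"]) (auto simp: T_mult algebra_simps E_add)
    qed
    have eigen_one: "\<exists>e\<in>E. T 1 = e * 1"
      using zeroE by (auto simp: T_def)
    have eigen_power: "\<exists>e\<in>E. T (f ^ m) = e * f ^ m" if "\<exists>e\<in>E. T f = e * f" for f m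
      by (induction m) (use that eigen_one in \<open>auto intro: eigen_mult\<close>)
    have "\<exists>e\<in>E. T (\<Prod>j\<in>F. y j ^ \<alpha> j) = e * (\<Prod>j\<in>F. y j ^ \<alpha> j)" if "F \<subseteq> S" for F \<alpha>
      using finite_subset[OF that assms(1)] that
    proof (induction F)
      case (insert i F)
      thus ?case
        using eigen_mult[OF eigen_power[OF y_eigen[of i], of "\<alpha> i"], of "\<Prod>j\<in>F. y j ^ \<alpha> j"]
        by simp
    qed (use eigen_one in auto)
    hence w_eigen: "\<exists>e\<in>E. T (w \<alpha>) = e * w \<alpha>" for \<alpha>
      by (auto simp: w_def)
    show ?thesis
    proof (rule semilinear_independence[where T = T and E = E and J = J and w = w])
      fix \<alpha> f assume "\<alpha> \<in> J" "f \<in> E"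
      then obtain p where p: "f = fps_of_poly p"
        by (auto simp: E_def)
      obtain e where e: "e \<in> E" "T (w \<alpha>) = e * w \<alpha>"
        using w_eigen by blast
      have "T f \<in> E"
        by (auto simp: T_def A_def p root simp flip: fps_of_poly_pderiv
          intro!: E_mult E_prod) (auto simp: E_def)
      thus "\<exists>e\<in>E. T (f * w \<alpha>) = e * w \<alpha>"
        using e \<open>f \<in> E\<close>
        by (intro bexI[of _ "T f + f * e"]) (auto simp: T_mult algebra_simps intro!: E_add E_mult)
    next
      fix \<alpha> \<beta> f g
      assume *: "\<alpha> \<in> J" "\<beta> \<in> J" "f \<in> E" "g \<in> E" "f \<noteq> 0" "g \<noteq> 0"
        and eq: "T (f * w \<alpha>) * (g * w \<beta>) = T (g * w \<beta>) * (f * w \<alpha>)"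
      obtain p q where pq: "f = fps_of_poly p" "g = fps_of_poly q"
        using * by (auto simp: E_def)
      define P Q where "P = p ^ k * (\<Prod>j\<in>S. a j ^ \<alpha> j)" and "Q = q ^ k * (\<Prod>j\<in>S. a j ^ \<beta> j)"
      have "A * (fps_deriv (f * w \<alpha>) * (g * w \<beta>)) = A * (fps_deriv (g * w \<beta>) * (f * w \<alpha>))"
        using eq unfolding T_def by (simp only: mult.assoc)
      hence "fps_deriv (f * w \<alpha>) * (g * w \<beta>) = fps_deriv (g * w \<beta>) * (f * w \<alpha>)"
        using A0 by (metis mult_cancel_left)
      from wronskian_power[OF this assms(2)]
      have "fps_of_poly (pderiv P * Q) = fps_of_poly (pderiv Q * P)"
        by (simp only: pq kth P_def Q_def fps_of_poly_pderiv fps_of_poly_mult[of "pderiv _"])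
      hence "pderiv P * Q = pderiv Q * P"
        by (simp only: fps_of_poly_eq_iff)
      moreover have "p \<noteq> 0" "q \<noteq> 0"
        using pq * by auto
      moreover from this have "P \<noteq> 0" "Q \<noteq> 0"
        using assms(1,2) nz by (auto simp: P_def Q_def)
      ultimately show "\<alpha> = \<beta>"
        using order_eq_if_wronskian_zero[OF char0] * by (intro eq_if_order_eq[of p _ q]) (auto simp: P_def Q_def)
    next
      show "(\<Sum>\<alpha>\<in>J. fps_of_poly (c \<alpha>) * w \<alpha>) = 0"
        using rel by (simp add: J_def w_def)
    qed (use fin w0 \<alpha> in \<open>auto simp: T_def algebra_simps E_diff E_mult J_def\<close>, auto simp: E_def)
  next
    case False
    hence p: "prime CHAR('a)" and cop: "coprime CHAR('a) k"
      using char prime_CHAR_semidom by (auto simp: coprime_commute)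
    define q where "q = CHAR('a) ^ totient k"
    have q0: "q > 0"
      using False by (simp add: q_def)
    have "[q = 1] (mod k)"
      unfolding q_def by (rule euler_theorem[OF cop])
    hence "k dvd q - 1"
      using q0 by (metis cong_sym cong_altdef_nat One_nat_def Suc_leI)
    then obtain r where r: "q - 1 = k * r"
      by blast
    have q1: "q = Suc (k * r)"
      using q0 r by simp
    have "q > 1"
      unfolding q_def using p assms(2) prime_gt_1_nat by (intro one_less_power) auto
    hence r0: "r > 0"
      using q1 by (cases r) auto
    define T :: "'a fps \<Rightarrow> _" where "T f = f ^ q" for f
    show ?thesis
    proof (rule semilinear_independence[where T = T and E = E and J = J and w = w])
      show "T (f + g) = T f + T g" for f g
        unfolding T_def by (rule freshmans_dream'[where n = "totient k"]) (use p in \<open>simp_all add: q_def\<close>)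
    next
      fix \<alpha> f assume *: "\<alpha> \<in> J" "f \<in> E"
      have "w \<alpha> ^ k = fps_of_poly (\<Prod>j\<in>S. a j ^ \<alpha> j)"
        using kth[of 1 \<alpha>] by simp
      hence "w \<alpha> ^ k \<in> E" by (simp add: E_def)
      moreover have "T (f * w \<alpha>) = (f ^ q * (w \<alpha> ^ k) ^ r) * w \<alpha>"
        by (simp add: T_def q1 power_mult power_mult_distrib algebra_simps)
      ultimately show "\<exists>e\<in>E. T (f * w \<alpha>) = e * w \<alpha>"
        using * by (intro bexI[of _ "f ^ q * (w \<alpha> ^ k) ^ r"]) (auto intro!: E_mult E_power)
    next
      fix \<alpha> \<beta> f g
      assume *: "\<alpha> \<in> J" "\<beta> \<in> J" "f \<in> E" "g \<in> E" "f \<noteq> 0" "g \<noteq> 0"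
        and eq: "T (f * w \<alpha>) * (g * w \<beta>) = T (g * w \<beta>) * (f * w \<alpha>)"
      obtain p q where pq: "f = fps_of_poly p" "g = fps_of_poly q"
        using * by (auto simp: E_def)
      define P Q where "P = p ^ k * (\<Prod>j\<in>S. a j ^ \<alpha> j)" and "Q = q ^ k * (\<Prod>j\<in>S. a j ^ \<beta> j)"
      have "((f * w \<alpha>) * (g * w \<beta>)) * ((f * w \<alpha>) ^ k) ^ r = ((f * w \<alpha>) * (g * w \<beta>)) * ((g * w \<beta>) ^ k) ^ r"
        using eq unfolding T_def q1 power_Suc power_mult by (simp only: mult_ac)
      hence "((f * w \<alpha>) ^ k) ^ r = ((g * w \<beta>) ^ k) ^ r"
        using w0 * by (metis mult_cancel_left mult_eq_0_iff)
      hence "P ^ r = Q ^ r"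
        by (simp only: pq kth P_def Q_def fps_of_poly_eq_iff flip: fps_of_poly_power)
      moreover have pq0: "p \<noteq> 0" "q \<noteq> 0"
        using pq * by auto
      moreover have "P \<noteq> 0" "Q \<noteq> 0"
        using pq0 assms(1,2) nz by (auto simp: P_def Q_def)
      moreover have "Polynomial.order x (R ^ r) = r * Polynomial.order x R" if "R \<noteq> 0" for x and R :: "'a poly"
        using that by (induction r) (auto simp: order_mult)
      ultimately have "Polynomial.order x P = Polynomial.order x Q" for x
        using r0 by (metis mult_cancel1 neq0_conv)
      thus "\<alpha> = \<beta>"
        using * pq0 by (intro eq_if_order_eq[of p _ q]) (auto simp: P_def Q_def)
    next
      show "(\<Sum>\<alpha>\<in>J. fps_of_poly (c \<alpha>) * w \<alpha>) = 0"
        using rel by (simp add: J_def w_def)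
    qed (use fin w0 \<alpha> in \<open>auto simp: E_diff E_mult J_def\<close>, auto simp: E_def)
  qed
  thus ?thesis
    by (metis fps_of_poly_0 fps_of_poly_eq_iff)
qed

section \<open>Evaluation and homogeneity\<close>

definition monom_eval :: "(nat \<Rightarrow> 'b::comm_ring_1) \<Rightarrow> (nat \<Rightarrow>\<^sub>0 nat) \<Rightarrow> 'b" where
  "monom_eval x m = (\<Prod>i\<in>Poly_Mapping.keys m. x i ^ Poly_Mapping.lookup m i)"

text \<open>
  The coefficients are mapped along \<open>h\<close>, so that the same polynomial can be evaluated at points over the field
  and at points over its power series ring.
\<close>

definition peval :: "('a::comm_ring_1 \<Rightarrow> 'b::comm_ring_1) \<Rightarrow> (nat \<Rightarrow> 'b) \<Rightarrow> 'a mpoly \<Rightarrow> 'b" where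
  "peval h x F = (\<Sum>m\<in>Poly_Mapping.keys F. h (Poly_Mapping.lookup F m) * monom_eval x m)"

definition mdeg :: "(nat \<Rightarrow>\<^sub>0 nat) \<Rightarrow> nat" where
  "mdeg m = (\<Sum>i\<in>Poly_Mapping.keys m. Poly_Mapping.lookup m i)"

lemma meval_eq_peval: "meval F x = peval (\<lambda>c. c) x F"
  by (simp add: meval_def peval_def monom_eval_def)

lemma monom_eval_superset:
  assumes "finite A" "Poly_Mapping.keys m \<subseteq> A"
  shows "monom_eval x m = (\<Prod>i\<in>A. x i ^ Poly_Mapping.lookup m i)"
  unfolding monom_eval_def
  by (rule prod.mono_neutral_left) (use assms in \<open>auto simp: in_keys_iff\<close>)

lemma mdeg_superset:
  assumes "finite A" "Poly_Mapping.keys m \<subseteq> A"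
  shows "mdeg m = (\<Sum>i\<in>A. Poly_Mapping.lookup m i)"
  unfolding mdeg_def
  by (rule sum.mono_neutral_left) (use assms in \<open>auto simp: in_keys_iff\<close>)

lemma monom_eval_add: "monom_eval x (m + m') = monom_eval x m * monom_eval x m'"
proof -
  let ?A = "Poly_Mapping.keys m \<union> Poly_Mapping.keys m'"
  have "monom_eval x (m + m') = (\<Prod>i\<in>?A. x i ^ Poly_Mapping.lookup (m + m') i)"
    using Poly_Mapping.keys_add[of m m'] by (intro monom_eval_superset) auto
  thus ?thesis
    using monom_eval_superset[of ?A m x] monom_eval_superset[of ?A m' x]
    by (simp add: lookup_add power_add prod.distrib)
qed

lemma mdeg_add: "mdeg (m + m') = mdeg m + mdeg m'"
proof -
  let ?A = "Poly_Mapping.keys m \<union> Poly_Mapping.keys m'"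
  have "mdeg (m + m') = (\<Sum>i\<in>?A. Poly_Mapping.lookup (m + m') i)"
    using Poly_Mapping.keys_add[of m m'] by (intro mdeg_superset) auto
  thus ?thesis
    using mdeg_superset[of ?A m] mdeg_superset[of ?A m']
    by (simp add: lookup_add sum.distrib)
qed

lemma monom_eval_0 [simp]: "monom_eval x 0 = 1"
  and mdeg_0 [simp]: "mdeg 0 = 0"
  by (simp_all add: monom_eval_def mdeg_def)

lemma monom_eval_single [simp]: "monom_eval x (Poly_Mapping.single i e) = x i ^ e"
  and mdeg_single [simp]: "mdeg (Poly_Mapping.single i e) = e"
  by (simp_all add: monom_eval_def mdeg_def)

lemma monom_eval_scale: "monom_eval (\<lambda>i. c * x i) m = c ^ mdeg m * monom_eval x m"
  by (simp add: monom_eval_def mdeg_def power_mult_distrib prod.distrib power_sum)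

lemma mpoly_as_sum:
  fixes F :: "'a::comm_ring_1 mpoly"
  shows "F = (\<Sum>m\<in>Poly_Mapping.keys F. Poly_Mapping.single m (Poly_Mapping.lookup F m))"
proof (rule poly_mapping_eqI)
  fix m
  have "Poly_Mapping.lookup (\<Sum>m\<in>Poly_Mapping.keys F. Poly_Mapping.single m (Poly_Mapping.lookup F m)) m
     = (\<Sum>m'\<in>Poly_Mapping.keys F. if m' = m then Poly_Mapping.lookup F m' else 0)"
    by (simp add: lookup_sum lookup_single when_def)
  also have "\<dots> = Poly_Mapping.lookup F m"
    by (simp add: in_keys_iff)
  finally show "Poly_Mapping.lookup F m = Poly_Mapping.lookup
      (\<Sum>m\<in>Poly_Mapping.keys F. Poly_Mapping.single m (Poly_Mapping.lookup F m)) m" ..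
qed

lemma homogeneous_iff:
  "homogeneous n d F \<longleftrightarrow>
     (\<forall>m. Poly_Mapping.lookup F m \<noteq> 0 \<longrightarrow> Poly_Mapping.keys m \<subseteq> {1..n+1} \<and> mdeg m = d)"
  by (auto simp: homogeneous_def mdeg_def in_keys_iff)

lemma homogeneous_0 [simp]: "homogeneous n d 0"
  by (simp add: homogeneous_iff)

lemma homogeneous_single:
  "Poly_Mapping.keys m \<subseteq> {1..n+1} \<Longrightarrow> mdeg m = d \<Longrightarrow> homogeneous n d (Poly_Mapping.single m c)"
  by (auto simp: homogeneous_iff lookup_single when_def)

lemma homogeneous_add: "homogeneous n d F \<Longrightarrow> homogeneous n d G \<Longrightarrow> homogeneous n d (F + G)"
  unfolding homogeneous_def using Poly_Mapping.keys_add[of F G] by blast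

lemma homogeneous_uminus: "homogeneous n d F \<Longrightarrow> homogeneous n d (- F)"
  by (auto simp: homogeneous_iff)

lemma homogeneous_diff: "homogeneous n d F \<Longrightarrow> homogeneous n d G \<Longrightarrow> homogeneous n d (F - G)"
  using homogeneous_add[of n d F "- G"] homogeneous_uminus[of n d G] by simp

lemma homogeneous_sum: "(\<And>i. i \<in> A \<Longrightarrow> homogeneous n d (f i)) \<Longrightarrow> homogeneous n d (sum f A)"
  by (induction A rule: infinite_finite_induct) (auto intro: homogeneous_add)

lemma homogeneous_mult:
  assumes "homogeneous n d F" "homogeneous n e G"
  shows "homogeneous n (d + e) (F * G)"
  unfolding homogeneous_def
proof
  fix m assume "m \<in> Poly_Mapping.keys (F * G)"
  then obtain a b where ab: "m = a + b" "a \<in> Poly_Mapping.keys F" "b \<in> Poly_Mapping.keys G"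
    using keys_mult[of F G] by blast
  have "mdeg m = d + e"
    using assms ab by (simp add: mdeg_add homogeneous_iff in_keys_iff)
  moreover have "Poly_Mapping.keys m \<subseteq> {1..n+1}"
    using assms ab Poly_Mapping.keys_add[of a b] by (fastforce simp: homogeneous_def)
  ultimately show "Poly_Mapping.keys m \<subseteq> {1..n+1} \<and>
      (\<Sum>i\<in>Poly_Mapping.keys m. Poly_Mapping.lookup m i) = d + e"
    by (simp add: mdeg_def)
qed

lemma homogeneous_mvar: "i \<in> {1..n+1} \<Longrightarrow> homogeneous n 1 (mvar i)"
  unfolding mvar_def by (rule homogeneous_single) auto

lemma homogeneous_mconst: "homogeneous n 0 (mconst c)"
  unfolding mconst_def by (rule homogeneous_single) auto

lemma mconst_1: "mconst 1 = 1"
  by (simp add: mconst_def)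

lemma homogeneous_1: "homogeneous n 0 1"
  using homogeneous_mconst[of n 1] by (simp add: mconst_1)

locale coefficient_hom =
  fixes h :: "'a::comm_ring_1 \<Rightarrow> 'b::comm_ring_1"
  assumes hom_add: "h (a + b) = h a + h b"
    and hom_mult: "h (a * b) = h a * h b"
    and hom_one: "h 1 = 1"
begin

lemma hom_zero: "h 0 = 0"
  using hom_add[of 0 0] by (metis add_0 add_cancel_left_left)

lemma peval_superset:
  assumes "finite A" "Poly_Mapping.keys F \<subseteq> A"
  shows "peval h x F = (\<Sum>m\<in>A. h (Poly_Mapping.lookup F m) * monom_eval x m)"
  unfolding peval_def
  by (rule sum.mono_neutral_left) (use assms in \<open>auto simp: in_keys_iff hom_zero\<close>)

lemma peval_0 [simp]: "peval h x 0 = 0"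
  by (simp add: peval_def)

lemma peval_single [simp]: "peval h x (Poly_Mapping.single m c) = h c * monom_eval x m"
  by (simp add: peval_def hom_zero)

lemma peval_add: "peval h x (F + G) = peval h x F + peval h x G"
proof -
  let ?A = "Poly_Mapping.keys F \<union> Poly_Mapping.keys G"
  have "peval h x (F + G) = (\<Sum>m\<in>?A. h (Poly_Mapping.lookup (F + G) m) * monom_eval x m)"
    using Poly_Mapping.keys_add[of F G] by (intro peval_superset) auto
  thus ?thesis
    using peval_superset[of ?A F x] peval_superset[of ?A G x]
    by (simp add: lookup_add hom_add algebra_simps sum.distrib)
qed

lemma peval_uminus: "peval h x (- F) = - peval h x F"
  using peval_add[of x F "- F"] by (simp add: eq_neg_iff_add_eq_0 add.commute)

lemma peval_diff: "peval h x (F - G) = peval h x F - peval h x G"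
  using peval_add[of x F "- G"] by (simp add: peval_uminus)

lemma peval_sum: "peval h x (sum f A) = (\<Sum>i\<in>A. peval h x (f i))"
  by (induction A rule: infinite_finite_induct) (auto simp: peval_add)

lemma peval_mult: "peval h x (F * G) = peval h x F * peval h x G"
proof -
  have "F * G = (\<Sum>m\<in>Poly_Mapping.keys F. \<Sum>m'\<in>Poly_Mapping.keys G.
      Poly_Mapping.single (m + m') (Poly_Mapping.lookup F m * Poly_Mapping.lookup G m'))"
    by (subst mpoly_as_sum[of F], subst mpoly_as_sum[of G]) (simp add: sum_product mult_single)
  thus ?thesis
    by (simp add: peval_sum peval_def[of h x F] peval_def[of h x G] sum_product monom_eval_add
        hom_mult algebra_simps)
qed

lemma peval_mconst [simp]: "peval h x (mconst c) = h c"
  by (simp add: mconst_def)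

lemma peval_1 [simp]: "peval h x 1 = 1"
  using peval_mconst[of x 1] by (simp add: mconst_1 hom_one)

lemma peval_mvar [simp]: "peval h x (mvar i) = x i"
  by (simp add: mvar_def hom_one)

lemma peval_scale:
  assumes "homogeneous n d F"
  shows "peval h (\<lambda>i. c * x i) F = c ^ d * peval h x F"
proof -
  have "\<And>m. m \<in> Poly_Mapping.keys F \<Longrightarrow> mdeg m = d"
    using assms by (simp add: homogeneous_iff in_keys_iff)
  thus ?thesis
    by (simp add: peval_def sum_distrib_left monom_eval_scale algebra_simps)
qed

lemma peval_cong:
  assumes "homogeneous n d F" "\<And>i. i \<in> {1..n+1} \<Longrightarrow> x i = y i"
  shows "peval h x F = peval h y F"
  unfolding peval_def monom_eval_def
  using assms by (intro sum.cong arg_cong2[of _ _ _ _ "(*)"] prod.cong) (auto simp: homogeneous_def, force)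

end

interpretation point: coefficient_hom "\<lambda>c::'a::comm_ring_1. c"
  by standard auto

interpretation series: coefficient_hom "fps_const :: 'a::comm_ring_1 \<Rightarrow> 'a fps"
  by standard auto

lemma fps_const_prod: "fps_const (prod f A) = (\<Prod>i\<in>A. fps_const (f i))"
  by (induction A rule: infinite_finite_induct) (simp_all flip: fps_const_mult)

lemma fps_const_sum: "fps_const (sum f A) = (\<Sum>i\<in>A. fps_const (f i))"
  by (induction A rule: infinite_finite_induct) (simp_all flip: fps_const_add)

text \<open>
  A point over the field is a power series point with constant coordinates, so an identity proved at
  all power series points on the cone also holds at the points over the field.
\<close>

lemma peval_const_point:
  "peval fps_const (\<lambda>i. fps_const (x i)) F = fps_const (meval F x)"
  by (simp add: meval_eq_peval peval_def monom_eval_def fps_const_power fps_const_prod fps_const_sum flip: fps_const_mult)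

section \<open>Polynomials vanishing on grids\<close>

lemma coeffs_zero_if_many_roots:
  fixes b :: "nat \<Rightarrow> 'a::idom"
  assumes "card Y \<ge> k" "\<And>t. t \<in> Y \<Longrightarrow> (\<Sum>i<k. b i * t ^ i) = 0" "i < k"
  shows "b i = 0"
proof -
  define p where "p = (\<Sum>i<k. monom (b i) i)"
  have coeff: "coeff p j = (if j < k then b j else 0)" for j
    by (simp add: p_def coeff_sum)
  have "p = 0"
  proof (rule ccontr)
    assume "p \<noteq> 0"
    have "degree p < k"
      using coeff assms(3) \<open>p \<noteq> 0\<close> leading_coeff_0_iff by (metis not_le)
    have "Y \<subseteq> {t. poly p t = 0}"
      using assms(2) by (auto simp: p_def poly_sum poly_monom)
    hence "card Y \<le> card {t. poly p t = 0}"
      using poly_roots_finite[OF \<open>p \<noteq> 0\<close>] by (rule card_mono[rotated])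
    also have "\<dots> \<le> degree p"
      using \<open>p \<noteq> 0\<close> by (rule card_poly_roots_bound)
    finally show False
      using \<open>degree p < k\<close> assms(1) by simp
  qed
  thus ?thesis
    using coeff[of i] assms(3) by simp
qed

lemma sum_PiE_insert:
  fixes f :: "('i \<Rightarrow> nat) \<Rightarrow> 'b::comm_monoid_add"
  assumes "finite S" "j \<notin> S"
  shows "(\<Sum>\<alpha>\<in>insert j S \<rightarrow>\<^sub>E {..<k}. f \<alpha>) = (\<Sum>i<k. \<Sum>\<alpha>\<in>S \<rightarrow>\<^sub>E {..<k}. f (\<alpha>(j := i)))"
proof -
  have "inj_on (\<lambda>(i, \<alpha>). \<alpha>(j := i)) ({..<k} \<times> (S \<rightarrow>\<^sub>E {..<k}))"
    using assms by (intro inj_combinator)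
  hence "(\<Sum>\<alpha>\<in>insert j S \<rightarrow>\<^sub>E {..<k}. f \<alpha>)
      = (\<Sum>(i, \<alpha>)\<in>{..<k} \<times> (S \<rightarrow>\<^sub>E {..<k}). f (\<alpha>(j := i)))"
    unfolding PiE_insert_eq by (subst sum.reindex) (auto simp: case_prod_unfold)
  thus ?thesis
    by (simp add: sum.cartesian_product)
qed

text \<open>
  A polynomial of degree less than \<open>k\<close> in each variable is determined by its values on a grid with \<open>k\<close>
  values for each variable.  By induction on the variables: fixing all but one of them leaves a univariate
  polynomial with too many roots.
\<close>

lemma coeffs_zero_if_vanishes_on_grid:
  fixes c :: "('i \<Rightarrow> nat) \<Rightarrow> 'a::idom"
  assumes "finite S" "\<And>j. j \<in> S \<Longrightarrow> card (Y j) \<ge> k"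
    and "\<And>y. y \<in> Pi S Y \<Longrightarrow> (\<Sum>\<alpha>\<in>S \<rightarrow>\<^sub>E {..<k}. c \<alpha> * (\<Prod>j\<in>S. y j ^ \<alpha> j)) = 0"
    and "\<alpha> \<in> S \<rightarrow>\<^sub>E {..<k}"
  shows "c \<alpha> = 0"
  using assms
proof (induction S arbitrary: c \<alpha> rule: finite_induct)
  case empty
  thus ?case by simp
next
  case (insert j S)
  have "c (\<beta>(j := i)) = 0" if i: "i < k" and \<beta>: "\<beta> \<in> S \<rightarrow>\<^sub>E {..<k}" for i \<beta>
  proof (rule insert.IH[of "\<lambda>\<beta>. c (\<beta>(j := i))"])
    fix y assume y: "y \<in> Pi S Y"
    define b where "b i = (\<Sum>\<alpha>\<in>S \<rightarrow>\<^sub>E {..<k}. c (\<alpha>(j := i)) * (\<Prod>j\<in>S. y j ^ \<alpha> j))" for i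
    have "(\<Sum>i<k. b i * t ^ i) = 0" if t: "t \<in> Y j" for t
    proof -
      have "(\<Prod>l\<in>insert j S. (y(j := t)) l ^ (\<alpha>(j := i)) l) = t ^ i * (\<Prod>l\<in>S. y l ^ \<alpha> l)" for \<alpha> i
      proof -
        have "(\<Prod>l\<in>S. (y(j := t)) l ^ (\<alpha>(j := i)) l) = (\<Prod>l\<in>S. y l ^ \<alpha> l)"
          using insert.hyps by (intro prod.cong) auto
        thus ?thesis using insert.hyps by simp
      qed
      hence "(\<Sum>i<k. b i * t ^ i)
          = (\<Sum>\<alpha>\<in>insert j S \<rightarrow>\<^sub>E {..<k}. c \<alpha> * (\<Prod>l\<in>insert j S. (y(j := t)) l ^ \<alpha> l))"
        unfolding sum_PiE_insert[OF insert.hyps] b_def sum_distrib_right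
        by (simp add: algebra_simps del: fun_upd_apply)
      also have "\<dots> = 0"
        using y t insert.hyps by (intro insert.prems(2)) auto
      finally show ?thesis .
    qed
    thus "(\<Sum>\<alpha>\<in>S \<rightarrow>\<^sub>E {..<k}. c (\<alpha>(j := i)) * (\<Prod>j\<in>S. y j ^ \<alpha> j)) = 0"
      using coeffs_zero_if_many_roots[of k "Y j" b i] insert.prems(1) i by (simp add: b_def)
  qed (use insert.prems \<beta> in auto)
  moreover obtain i \<beta> where "\<alpha> = \<beta>(j := i)" "i < k" "\<beta> \<in> S \<rightarrow>\<^sub>E {..<k}"
    using insert.prems(3) unfolding PiE_insert_eq by auto
  ultimately show ?case by (simp del: fun_upd_apply)
qed

lemma card_nth_roots:
  fixes b :: "'a::alg_closed_field"
  assumes "k > 0" "of_nat k \<noteq> (0::'a)" "b \<noteq> 0"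
  shows "card {t. t ^ k = b} = k"
proof -
  define p where "p = monom 1 k + [:-b:]"
  have poly: "poly p t = t ^ k - b" for t
    by (simp add: p_def poly_monom)
  have "p \<noteq> 0"
    using poly[of 0] assms by (auto simp: zero_power)
  have deg: "degree p = k"
    unfolding p_def using assms(1)
    by (subst degree_add_eq_left) (auto simp: degree_monom_eq)
  obtain A where A: "size A = k" "p = smult (lead_coeff p) (\<Prod>x\<in>#A. [:-x, 1:])"
    using alg_closed_imp_factorization[OF \<open>p \<noteq> 0\<close>] deg by auto
  have roots: "t \<in># A \<longleftrightarrow> t ^ k = b" for t
  proof -
    have "poly p t = lead_coeff p * (\<Prod>x\<in>#A. t - x)"
      by (subst A(2)) (simp add: poly_prod_mset image_mset.compositionality o_def)
    moreover have "(\<Prod>x\<in>#A. t - x) = 0 \<longleftrightarrow> t \<in># A"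
      by (induction A) auto
    ultimately show ?thesis
      using poly[of t] \<open>p \<noteq> 0\<close>
      by (metis eq_iff_diff_eq_0 mult_eq_0_iff leading_coeff_0_iff)
  qed
  \<comment> \<open>a double root would be a zero of the derivative \<open>k t\<^bsup>k-1\<^esup>\<close>, hence \<open>0\<close>, but \<open>0\<^sup>k \<noteq> b\<close>\<close>
  have mult: "count A t \<le> 1" for t
  proof (rule ccontr)
    assume "\<not> count A t \<le> 1"
    hence "t \<in># A" "t \<in># A - {#t#}"
      by (auto simp flip: count_greater_zero_iff)
    then obtain B where "A = add_mset t (add_mset t B)"
      by (metis insert_DiffM)
    hence "p = [:-t, 1:] * ([:-t, 1:] * smult (lead_coeff p) (\<Prod>x\<in>#B. [:-x, 1:]))"
      using A(2) by (metis (no_types, lifting) image_mset_add_mset mult_smult_right prod_mset.add_mset)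
    then obtain r where r: "p = [:-t, 1:] * ([:-t, 1:] * r)"
      by blast
    have "poly (pderiv p) t = 0"
      by (subst r) (simp only: pderiv_mult poly_add poly_mult, simp)
    hence "of_nat k * t ^ (k - 1) = 0"
      by (simp add: p_def pderiv_add pderiv_monom pderiv_pCons poly_monom)
    hence "t = 0"
      using assms(2) by simp
    thus False
      using roots[of t] \<open>t \<in># A\<close> assms by (simp add: zero_power)
  qed
  hence "A = mset_set (set_mset A)"
  proof (intro multiset_eqI)
    fix t
    show "count A t = count (mset_set (set_mset A)) t"
      using mult[of t] by (cases "t \<in># A") (auto simp: not_in_iff simp flip: count_greater_zero_iff)
  qed
  hence "k = card (set_mset A)"
    using A(1) by (metis size_mset_set)
  also have "set_mset A = {t. t ^ k = b}"
    using roots by blast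
  finally show ?thesis by simp
qed

text \<open>
  Otherwise the nonconstant polynomial \<open>p + 1\<close> would have no root.
\<close>

lemma alg_closed_nonroot_exists:
  fixes p :: "'a::alg_closed_field poly"
  assumes "p \<noteq> 0"
  obtains z where "poly p z \<noteq> 0"
proof -
  have "\<exists>z. poly p z \<noteq> 0"
  proof (rule ccontr)
    assume *: "\<not> (\<exists>z. poly p z \<noteq> 0)"
    hence "degree p > 0"
      using assms by (metis degree_eq_zeroE gr0I mult_zero_right pCons_0_0 poly_0 poly_pCons add.right_neutral)
    hence "degree (p + 1) > 0"
      by (subst degree_add_eq_left) auto
    then obtain z where "poly (p + 1) z = 0"
      using alg_closed_imp_poly_has_root by blast
    thus False using * by simp
  qed
  thus ?thesis using that by blast
qed

section \<open>The cone over the curve and its generic point\<close>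

lemma equiv_proj_rel:
  "equiv (nonzero_vecs n) (proj_rel n :: ((nat \<Rightarrow> 'a::field) \<times> (nat \<Rightarrow> 'a)) set)" (is "equiv ?V ?R")
proof (rule equivI)
  show "?R \<subseteq> ?V \<times> ?V"
    by (auto simp: proj_rel_def)
  show "refl_on ?V ?R"
    by (auto simp: refl_on_def proj_rel_def intro: exI[of _ 1])
  show "sym ?R"
  proof (rule symI)
    fix x y :: "nat \<Rightarrow> 'a" assume "(x, y) \<in> proj_rel n"
    then obtain c where "x \<in> nonzero_vecs n" "y \<in> nonzero_vecs n" "c \<noteq> 0" "\<forall>i\<in>{1..n+1}. y i = c * x i"
      by (auto simp: proj_rel_def)
    thus "(y, x) \<in> proj_rel n"
      by (auto simp: proj_rel_def intro!: exI[of _ "inverse c"])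
  qed
  show "trans ?R"
  proof (rule transI)
    fix x y z :: "nat \<Rightarrow> 'a" assume "(x, y) \<in> proj_rel n" "(y, z) \<in> proj_rel n"
    then obtain c d where "x \<in> nonzero_vecs n" "z \<in> nonzero_vecs n" "c \<noteq> 0" "d \<noteq> 0"
        "\<forall>i\<in>{1..n+1}. y i = c * x i" "\<forall>i\<in>{1..n+1}. z i = d * y i"
      by (auto simp: proj_rel_def)
    thus "(x, z) \<in> proj_rel n"
      by (auto simp: proj_rel_def intro!: exI[of _ "d * c"])
  qed
qed

locale generalized_fermat =
  fixes k n :: nat and lam :: "nat \<Rightarrow> 'a::alg_closed_field"
  assumes k_ge_2: "k \<ge> 2" and n_ge_2: "n \<ge> 2"
    and char: "CHAR('a) > 0 \<longrightarrow> coprime k CHAR('a)"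
    and lam_not_01: "\<forall>i\<in>{1..n-2}. lam i \<notin> {0, 1}"
    and inj_lam: "inj_on lam {1..n-2}"
begin

abbreviation "S \<equiv> {3..n+1}"
abbreviation "curve \<equiv> gf_curve k n lam"

text \<open>
  With this indexing all equations of the curve have the form \<open>\<mu>\<^sub>j x\<^sub>1\<^sup>k + x\<^sub>2\<^sup>k + x\<^sub>j\<^sup>k = 0\<close> for \<open>j \<in> S\<close>.
\<close>

definition mu :: "nat \<Rightarrow> 'a" where
  "mu j = (if j = 3 then 1 else lam (j - 3))"

text \<open>
  On the chart \<open>x\<^sub>1 = 1\<close>, with \<open>z = x\<^sub>2\<close>, this is the polynomial in \<open>z\<close> of which \<open>x\<^sub>j\<close> is a \<open>k\<close>-th root;
  its zeros are the branch points of \<open>x\<^sub>j\<close>.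
\<close>

definition branch :: "nat \<Rightarrow> 'a poly" where
  "branch j = - (monom 1 k + [:mu j:])"

definition radical :: "nat \<Rightarrow> 'a fps" where
  "radical j = (SOME v. v ^ k = fps_of_poly (branch j))"

text \<open>
  The branch of the curve over \<open>z = 0\<close> that is parametrised by \<open>z\<close>.  It exists because no branch point lies at 0.
\<close>

definition generic :: "nat \<Rightarrow> 'a fps" where
  "generic i = (if i = 1 then 1 else if i = 2 then fps_X else radical i)"

definition on_cone :: "('a \<Rightarrow> 'b::comm_ring_1) \<Rightarrow> (nat \<Rightarrow> 'b) \<Rightarrow> bool" where
  "on_cone h x \<longleftrightarrow> (\<forall>j\<in>S. h (mu j) * x 1 ^ k + x 2 ^ k + x j ^ k = 0)"

lemma of_nat_k: "of_nat k \<noteq> (0::'a)"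
proof
  assume "of_nat k = (0::'a)"
  hence "CHAR('a) dvd k"
    by (simp add: of_nat_eq_0_iff_char_dvd)
  thus False
  proof (cases "CHAR('a) = 0")
    case False
    hence "coprime k CHAR('a)"
      using char by simp
    hence "CHAR('a) = 1"
      using \<open>CHAR('a) dvd k\<close> by (metis coprime_absorb_right is_unit_gcd nat_dvd_1_iff_1)
    thus False
      by (metis of_nat_1 of_nat_CHAR one_neq_zero)
  qed (use k_ge_2 in auto)
qed

lemma mu_nonzero: "j \<in> S \<Longrightarrow> mu j \<noteq> 0"
proof (cases "j = 3")
  case False
  moreover assume "j \<in> S"
  ultimately have "j - 3 \<in> {1..n-2}"
    by auto
  thus "mu j \<noteq> 0"
    using lam_not_01 False by (auto simp: mu_def)
qed (simp add: mu_def)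

lemma inj_mu: "i \<in> S \<Longrightarrow> j \<in> S \<Longrightarrow> mu i = mu j \<Longrightarrow> i = j"
proof -
  assume ij: "i \<in> S" "j \<in> S" "mu i = mu j"
  have range: "l - 3 \<in> {1..n-2}" if "l \<in> S" "l \<noteq> 3" for l
    using that by auto
  have "lam (l - 3) \<noteq> 1" if "l \<in> S" "l \<noteq> 3" for l
    using range[OF that] lam_not_01 by auto
  thus "i = j"
    using ij inj_onD[OF inj_lam, of "i - 3" "j - 3"] range[of i] range[of j]
    by (auto simp: mu_def split: if_splits)
qed

lemma poly_branch: "poly (branch j) z = - (z ^ k + mu j)"
  by (simp add: branch_def poly_monom)

lemma branch_nonzero: "j \<in> S \<Longrightarrow> branch j \<noteq> 0"
  using poly_branch[of j 0] mu_nonzero[of j] k_ge_2 by (auto simp: zero_power)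

text \<open>
  Zeros are simple as \<open>k\<close> is nonzero in the field and \<open>b \<noteq> 0\<close>; distinct equations have distinct branch points as
  the \<open>\<mu>\<^sub>j\<close> are distinct.
\<close>

lemma branch_order:
  assumes j: "j \<in> S" and b: "b ^ k = - mu j"
  shows "Polynomial.order b (branch j) = 1"
    and "i \<in> S \<Longrightarrow> i \<noteq> j \<Longrightarrow> Polynomial.order b (branch i) = 0"
proof -
  have b0: "b \<noteq> 0"
    using b mu_nonzero[OF j] k_ge_2 by (auto simp: zero_power)
  have root: "poly (branch j) b = 0"
    using b by (simp add: poly_branch)
  have "\<not> [:-b, 1:] ^ 2 dvd branch j"
  proof
    assume "[:-b, 1:] ^ 2 dvd branch j"
    then obtain r where "branch j = [:-b, 1:] ^ 2 * r"
      by (rule dvdE)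
    hence r: "branch j = [:-b, 1:] * ([:-b, 1:] * r)"
      by (simp only: power2_eq_square mult.assoc)
    have "poly (pderiv (branch j)) b = 0"
      by (subst r) (simp only: pderiv_mult poly_add poly_mult, simp)
    hence "of_nat k * b ^ (k - 1) = 0"
      by (simp add: branch_def pderiv_minus pderiv_diff pderiv_monom pderiv_pCons poly_monom)
    thus False using of_nat_k b0 by simp
  qed
  hence "Polynomial.order b (branch j) < 2"
    using branch_nonzero[OF j] order_divides[of b 2 "branch j"] by auto
  moreover have "Polynomial.order b (branch j) \<noteq> 0"
    using root branch_nonzero[OF j] order_root[of "branch j" b] by simp
  ultimately show "Polynomial.order b (branch j) = 1"
    by simp
next
  assume i: "i \<in> S" "i \<noteq> j"
  have "poly (branch i) b \<noteq> 0"
    using b inj_mu[OF i(1) j] i(2) by (auto simp: poly_branch)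
  thus "Polynomial.order b (branch i) = 0"
    by (simp add: order_0I)
qed

lemma radical_power: "j \<in> S \<Longrightarrow> radical j ^ k = fps_of_poly (branch j)"
proof -
  assume j: "j \<in> S"
  have "fps_of_poly (branch j) $ 0 \<noteq> 0"
    using poly_branch[of j 0] mu_nonzero[OF j] k_ge_2 by (simp add: zero_power poly_0_coeff_0)
  then obtain v where "v ^ k = fps_of_poly (branch j)"
    using fps_nth_root_exists[of k "fps_of_poly (branch j)"] k_ge_2 of_nat_k by auto
  thus ?thesis unfolding radical_def by (rule someI)
qed

lemma generic_on_cone: "on_cone fps_const generic"
  unfolding on_cone_def
proof
  fix j assume j: "j \<in> S"
  have "fps_of_poly (branch j) = - (fps_X ^ k + fps_const (mu j))"
    by (simp add: branch_def fps_of_poly_uminus fps_of_poly_add fps_of_poly_monom fps_of_poly_const)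
  moreover have "generic 1 = 1" "generic 2 = fps_X" "generic j ^ k = fps_of_poly (branch j)"
    using j by (auto simp: generic_def radical_power)
  ultimately show "fps_const (mu j) * generic 1 ^ k + generic 2 ^ k + generic j ^ k = 0"
    by simp
qed

lemma radical_monomials_independent:
  assumes "(\<Sum>\<alpha>\<in>S \<rightarrow>\<^sub>E {..<k}. fps_of_poly (c \<alpha>) * (\<Prod>j\<in>S. radical j ^ \<alpha> j)) = 0"
    and "\<alpha> \<in> S \<rightarrow>\<^sub>E {..<k}"
  shows "c \<alpha> = 0"
proof -
  define b where "b j = (SOME b. b ^ k = - mu j)" for j
  have b: "b j ^ k = - mu j" for j
    unfolding b_def by (rule someI_ex[OF nth_root_exists]) (use k_ge_2 in simp)
  show ?thesis
  proof (rule radicals_independent[where y = radical and a = branch and b = b and S = S and k = k and c = c and \<alpha> = \<alpha>])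
    show "k > 0" using k_ge_2 by simp
    show "coprime k CHAR('a) \<or> CHAR('a) = 0"
      using char by auto
    show "Polynomial.order (b j) (branch i) = 0" if "i \<in> S" "j \<in> S" "i \<noteq> j" for i j
      using branch_order(2)[OF that(2) b that(1,3)] .
    show "Polynomial.order (b j) (branch j) = 1" if "j \<in> S" for j
      using branch_order(1)[OF that b] .
  qed (fact finite_atLeastAtMost radical_power branch_nonzero assms)+
qed

section \<open>Reduction to exponents below k\<close>

definition reduced :: "'a mpoly \<Rightarrow> bool" where
  "reduced F \<longleftrightarrow> (\<forall>m\<in>Poly_Mapping.keys F. \<forall>j\<in>S. Poly_Mapping.lookup m j < k)"

text \<open>
  Congruence modulo the equations of the cone, tested on power series points.
\<close>

definition cone_congruent :: "'a mpoly \<Rightarrow> 'a mpoly \<Rightarrow> bool" where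
  "cone_congruent F G \<longleftrightarrow> (\<forall>u. on_cone fps_const u \<longrightarrow> peval fps_const u F = peval fps_const u G)"

lemma reduced_add: "reduced F \<Longrightarrow> reduced G \<Longrightarrow> reduced (F + G)"
  unfolding reduced_def using Poly_Mapping.keys_add[of F G] by blast

lemma reduced_uminus: "reduced F \<Longrightarrow> reduced (- F)"
  by (simp add: reduced_def)

lemma reduced_diff: "reduced F \<Longrightarrow> reduced G \<Longrightarrow> reduced (F - G)"
  using reduced_add[of F "- G"] reduced_uminus[of G] by simp

lemma reduced_sum: "(\<And>i. i \<in> A \<Longrightarrow> reduced (f i)) \<Longrightarrow> reduced (sum f A)"
  by (induction A rule: infinite_finite_induct) (auto intro: reduced_add, simp_all add: reduced_def)

lemma reduced_mconst_mult: "reduced F \<Longrightarrow> reduced (mconst c * F)"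
  unfolding reduced_def mconst_def using keys_mult[of "Poly_Mapping.single 0 c" F]
  by (force split: if_splits)

lemma homogeneous_mconst_mult: "homogeneous n d F \<Longrightarrow> homogeneous n d (mconst c * F)"
  using homogeneous_mult[OF homogeneous_mconst[of n c], of d F] by simp

text \<open>
  Replacing a factor \<open>x\<^sub>j\<^sup>k\<close> by \<open>- (\<mu>\<^sub>j x\<^sub>1\<^sup>k + x\<^sub>2\<^sup>k)\<close> keeps the degree and lowers the total exponent of
  the variables in \<open>S\<close>, on which the induction runs.
\<close>

lemma reduced_form_of_monomial:
  assumes "Poly_Mapping.keys m \<subseteq> {1..n+1}"
  shows "\<exists>G. homogeneous n (mdeg m) G \<and> reduced G \<and> cone_congruent (Poly_Mapping.single m 1) G"
  using assms
proof (induction "\<Sum>j\<in>S. Poly_Mapping.lookup m j" arbitrary: m rule: less_induct)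
  case less
  show ?case
  proof (cases "\<forall>j\<in>S. Poly_Mapping.lookup m j < k")
    case True
    thus ?thesis
      using less.prems homogeneous_single[of m n "mdeg m" 1]
      by (intro exI[of _ "Poly_Mapping.single m 1"]) (auto simp: reduced_def cone_congruent_def)
  next
    case False
    then obtain j where j: "j \<in> S" "k \<le> Poly_Mapping.lookup m j"
      by (auto simp: not_less)
    define l where "l = m - Poly_Mapping.single j k"
    have m: "m = l + Poly_Mapping.single j k"
      using j by (intro poly_mapping_eqI) (auto simp: l_def lookup_add lookup_minus lookup_single when_def)
    have keys_l: "Poly_Mapping.keys l \<subseteq> {1..n+1}"
      using less.prems by (auto simp: l_def in_keys_iff lookup_minus)
    \<comment> \<open>the monomial \<open>m\<close> with its factor \<open>x\<^sub>j\<^sup>k\<close> replaced by \<open>x\<^sub>i\<^sup>k\<close>, needed for \<open>i = 1, 2\<close>\<close>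
    define m' where "m' i = l + Poly_Mapping.single i k" for i
    have "\<exists>G. homogeneous n (mdeg m) G \<and> reduced G \<and> cone_congruent (Poly_Mapping.single (m' i) 1) G"
      if i: "i \<in> {1, 2}" for i
    proof -
      have "mdeg (m' i) = mdeg m"
        by (simp add: m m'_def mdeg_add)
      moreover have "(\<Sum>j\<in>S. Poly_Mapping.lookup (m' i) j) < (\<Sum>j\<in>S. Poly_Mapping.lookup m j)"
      proof (rule sum_strict_mono_ex1)
        show "\<forall>j\<in>S. Poly_Mapping.lookup (m' i) j \<le> Poly_Mapping.lookup m j"
          using i by (auto simp: m m'_def lookup_add lookup_single when_def)
        show "\<exists>j\<in>S. Poly_Mapping.lookup (m' i) j < Poly_Mapping.lookup m j"
          using i j(1) k_ge_2 by (intro bexI[of _ j]) (auto simp: m m'_def lookup_add lookup_single when_def)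
      qed auto
      moreover have "Poly_Mapping.keys (m' i) \<subseteq> {1..n+1}"
        using Poly_Mapping.keys_add[of l "Poly_Mapping.single i k"] keys_l i n_ge_2
        by (auto simp: m'_def split: if_splits)
      ultimately show ?thesis
        using less.hyps[of "m' i"] by simp
    qed
    from this[of 1] this[of 2] obtain G1 G2
      where G1: "homogeneous n (mdeg m) G1" "reduced G1" "cone_congruent (Poly_Mapping.single (m' 1) 1) G1"
        and G2: "homogeneous n (mdeg m) G2" "reduced G2" "cone_congruent (Poly_Mapping.single (m' 2) 1) G2"
      by auto
    define H where "H = - (mconst (mu j) * G1) - G2"
    have "homogeneous n (mdeg m) H" "reduced H"
      unfolding H_def using G1 G2
      by (auto intro!: homogeneous_diff homogeneous_uminus homogeneous_mconst_mult
          reduced_diff reduced_uminus reduced_mconst_mult)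
    moreover have "cone_congruent (Poly_Mapping.single m 1) H"
      unfolding cone_congruent_def
    proof (intro allI impI)
      fix u :: "nat \<Rightarrow> 'a fps" assume u: "on_cone fps_const u"
      have "peval fps_const u G1 = monom_eval u l * u 1 ^ k"
        "peval fps_const u G2 = monom_eval u l * u 2 ^ k"
        using G1(3) G2(3) u by (auto simp: cone_congruent_def m'_def monom_eval_add)
      hence "peval fps_const u H = monom_eval u l * - (fps_const (mu j) * u 1 ^ k + u 2 ^ k)"
        by (simp add: H_def series.peval_diff series.peval_uminus series.peval_mult algebra_simps)
      moreover have "u j ^ k = - (fps_const (mu j) * u 1 ^ k + u 2 ^ k)"
        using u j(1) unfolding on_cone_def by (metis add.commute eq_neg_iff_add_eq_0)
      ultimately show "peval fps_const u (Poly_Mapping.single m 1) = peval fps_const u H"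
        by (simp add: m monom_eval_add)
    qed
    ultimately show ?thesis by blast
  qed
qed

lemma reduced_form_exists:
  assumes "homogeneous n d F"
  obtains G where "homogeneous n d G" "reduced G" "cone_congruent F G"
proof -
  have "\<forall>m\<in>Poly_Mapping.keys F. \<exists>G. homogeneous n d G \<and> reduced G \<and> cone_congruent (Poly_Mapping.single m 1) G"
  proof
    fix m assume "m \<in> Poly_Mapping.keys F"
    hence "Poly_Mapping.keys m \<subseteq> {1..n+1}" "mdeg m = d"
      using assms by (auto simp: homogeneous_def mdeg_def)
    thus "\<exists>G. homogeneous n d G \<and> reduced G \<and> cone_congruent (Poly_Mapping.single m 1) G"
      using reduced_form_of_monomial[of m] by simp
  qed
  then obtain g where g: "\<And>m. m \<in> Poly_Mapping.keys F \<Longrightarrow>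
      homogeneous n d (g m) \<and> reduced (g m) \<and> cone_congruent (Poly_Mapping.single m 1) (g m)"
    by metis
  define G where "G = (\<Sum>m\<in>Poly_Mapping.keys F. mconst (Poly_Mapping.lookup F m) * g m)"
  show ?thesis
  proof
    show "homogeneous n d G" "reduced G"
      unfolding G_def using g
      by (auto intro!: homogeneous_sum homogeneous_mconst_mult reduced_sum reduced_mconst_mult)
    show "cone_congruent F G"
      unfolding cone_congruent_def
    proof (intro allI impI)
      fix u :: "nat \<Rightarrow> 'a fps" assume u: "on_cone fps_const u"
      have "peval fps_const u (g m) = monom_eval u m" if "m \<in> Poly_Mapping.keys F" for m
        using g[OF that] u by (auto simp: cone_congruent_def)
      thus "peval fps_const u F = peval fps_const u G"
        by (simp add: G_def series.peval_sum series.peval_mult peval_def[of _ _ F])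
    qed
  qed
qed

text \<open>
  The polynomial \<open>c\<^sub>\<alpha>\<close> in \<open>F(1, z, y) = \<Sum>\<^sub>\<alpha> c\<^sub>\<alpha>(z) y\<^sup>\<alpha>\<close>.
\<close>

definition coeff_poly :: "'a mpoly \<Rightarrow> (nat \<Rightarrow> nat) \<Rightarrow> 'a poly" where
  "coeff_poly F \<alpha> = (\<Sum>m | m \<in> Poly_Mapping.keys F \<and> restrict (Poly_Mapping.lookup m) S = \<alpha>.
     monom (Poly_Mapping.lookup F m) (Poly_Mapping.lookup m 2))"

lemma peval_reduced:
  fixes h :: "'a \<Rightarrow> 'b::comm_ring_1"
  assumes "homogeneous n d F" "reduced F" "x 1 = 1"
  shows "peval h x F = (\<Sum>\<alpha>\<in>S \<rightarrow>\<^sub>E {..<k}.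
      (\<Sum>m | m \<in> Poly_Mapping.keys F \<and> restrict (Poly_Mapping.lookup m) S = \<alpha>.
        h (Poly_Mapping.lookup F m) * x 2 ^ Poly_Mapping.lookup m 2) * (\<Prod>j\<in>S. x j ^ \<alpha> j))"
proof -
  have "(\<lambda>m. restrict (Poly_Mapping.lookup m) S) ` Poly_Mapping.keys F \<subseteq> S \<rightarrow>\<^sub>E {..<k}"
    using assms(2) by (auto simp: reduced_def)
  hence "peval h x F = (\<Sum>\<alpha>\<in>S \<rightarrow>\<^sub>E {..<k}.
      \<Sum>m | m \<in> Poly_Mapping.keys F \<and> restrict (Poly_Mapping.lookup m) S = \<alpha>.
        h (Poly_Mapping.lookup F m) * monom_eval x m)"
    unfolding peval_def by (subst sum.group) (auto intro: finite_PiE)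
  also have "\<dots> = (\<Sum>\<alpha>\<in>S \<rightarrow>\<^sub>E {..<k}.
      (\<Sum>m | m \<in> Poly_Mapping.keys F \<and> restrict (Poly_Mapping.lookup m) S = \<alpha>.
        h (Poly_Mapping.lookup F m) * x 2 ^ Poly_Mapping.lookup m 2) * (\<Prod>j\<in>S. x j ^ \<alpha> j))"
    unfolding sum_distrib_right
  proof (intro sum.cong refl)
    fix \<alpha> m assume "m \<in> {m \<in> Poly_Mapping.keys F. restrict (Poly_Mapping.lookup m) S = \<alpha>}"
    hence m: "m \<in> Poly_Mapping.keys F" and \<alpha>: "\<alpha> = restrict (Poly_Mapping.lookup m) S"
      by auto
    have "{1..n+1} = insert 1 (insert 2 S)"
      using n_ge_2 by auto
    moreover have "monom_eval x m = (\<Prod>i\<in>{1..n+1}. x i ^ Poly_Mapping.lookup m i)"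
      using m assms(1) by (intro monom_eval_superset) (auto simp: homogeneous_def)
    ultimately have "monom_eval x m = x 2 ^ Poly_Mapping.lookup m 2 * (\<Prod>j\<in>S. x j ^ \<alpha> j)"
      using assms(3) by (simp add: \<alpha>)
    thus "h (Poly_Mapping.lookup F m) * monom_eval x m =
        h (Poly_Mapping.lookup F m) * x 2 ^ Poly_Mapping.lookup m 2 * (\<Prod>j\<in>S. x j ^ \<alpha> j)"
      by (simp add: mult.assoc)
  qed
  finally show ?thesis .
qed

text \<open>
  Setting \<open>x\<^sub>1 = 1\<close> loses nothing: in a homogeneous polynomial the exponent of \<open>x\<^sub>1\<close> is determined by the
  other exponents and the degree, so every coefficient of \<open>F\<close> is a coefficient of some \<open>c\<^sub>\<alpha>\<close>.
\<close>

lemma reduced_zero_if_coeff_polys_zero: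
  assumes F: "homogeneous n d F" "reduced F" and zero: "\<And>\<alpha>. \<alpha> \<in> S \<rightarrow>\<^sub>E {..<k} \<Longrightarrow> coeff_poly F \<alpha> = 0"
  shows "F = 0"
proof (rule ccontr)
  assume "F \<noteq> 0"
  then obtain m where m: "m \<in> Poly_Mapping.keys F"
    by (metis ex_in_conv keys_eq_empty)
  define \<alpha> where "\<alpha> = restrict (Poly_Mapping.lookup m) S"
  have \<alpha>: "\<alpha> \<in> S \<rightarrow>\<^sub>E {..<k}"
    using F(2) m by (auto simp: reduced_def \<alpha>_def)
  have unique: "m' = m"
    if m': "m' \<in> Poly_Mapping.keys F" "restrict (Poly_Mapping.lookup m') S = \<alpha>"
      and "Poly_Mapping.lookup m' 2 = Poly_Mapping.lookup m 2" for m'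
  proof -
    have S: "Poly_Mapping.lookup m' j = Poly_Mapping.lookup m j" if "j \<in> S" for j
      using m'(2) that unfolding \<alpha>_def by (metis restrict_apply')
    have "mdeg m' = mdeg m"
      using F(1) m m' by (simp add: homogeneous_def mdeg_def)
    moreover have coords: "{1..n+1} = insert 1 (insert 2 S)"
      using n_ge_2 by auto
    have "mdeg l = Poly_Mapping.lookup l 1 + (Poly_Mapping.lookup l 2 + (\<Sum>i\<in>S. Poly_Mapping.lookup l i))"
      if "l \<in> Poly_Mapping.keys F" for l
    proof -
      have "mdeg l = (\<Sum>i\<in>insert 1 (insert 2 S). Poly_Mapping.lookup l i)"
        using F(1) that unfolding coords[symmetric]
        by (intro mdeg_superset) (auto simp: homogeneous_def)
      thus ?thesis
        by (subst (asm) sum.insert, simp, simp, subst (asm) sum.insert) simp_all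
    qed
    moreover have "(\<Sum>i\<in>S. Poly_Mapping.lookup m' i) = (\<Sum>i\<in>S. Poly_Mapping.lookup m i)"
      using S by (rule sum.cong[OF refl])
    ultimately have 1: "Poly_Mapping.lookup m' 1 = Poly_Mapping.lookup m 1"
      using m m'(1) that(3) by fastforce
    have "Poly_Mapping.lookup l i = 0" if "l \<in> Poly_Mapping.keys F" "i \<notin> {1..n+1}" for l i
      using F(1) that by (metis homogeneous_def in_keys_iff subsetD)
    thus ?thesis
      using m m' 1 that(3) S coords by (intro poly_mapping_eqI) (metis insert_iff)
  qed
  have "poly.coeff (coeff_poly F \<alpha>) (Poly_Mapping.lookup m 2)
     = (\<Sum>m' | m' \<in> Poly_Mapping.keys F \<and> restrict (Poly_Mapping.lookup m') S = \<alpha>.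
         if m' = m then Poly_Mapping.lookup F m' else 0)"
    unfolding coeff_poly_def coeff_sum
    using unique by (intro sum.cong) (auto simp: coeff_monom)
  also have "\<dots> = Poly_Mapping.lookup F m"
    using m by (subst sum.delta) (auto simp: \<alpha>_def)
  finally show False
    using zero[OF \<alpha>] m by (simp add: in_keys_iff)
qed

lemma reduced_zero_if_generic_zero:
  assumes "homogeneous n d F" "reduced F" "peval fps_const generic F = 0"
  shows "F = 0"
proof (rule reduced_zero_if_coeff_polys_zero[OF assms(1,2)])
  have "fps_of_poly (coeff_poly F \<alpha>)
     = (\<Sum>m | m \<in> Poly_Mapping.keys F \<and> restrict (Poly_Mapping.lookup m) S = \<alpha>.
        fps_const (Poly_Mapping.lookup F m) * generic 2 ^ Poly_Mapping.lookup m 2)" for \<alpha>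
    by (simp add: coeff_poly_def fps_of_poly_sum fps_of_poly_monom generic_def)
  moreover have "(\<Prod>j\<in>S. radical j ^ \<alpha> j) = (\<Prod>j\<in>S. generic j ^ \<alpha> j)" for \<alpha>
    by (intro prod.cong) (auto simp: generic_def)
  ultimately have "(\<Sum>\<alpha>\<in>S \<rightarrow>\<^sub>E {..<k}. fps_of_poly (coeff_poly F \<alpha>) * (\<Prod>j\<in>S. radical j ^ \<alpha> j)) = 0"
    using peval_reduced[OF assms(1,2), of generic fps_const] assms(3) by (simp add: generic_def)
  thus "coeff_poly F \<alpha> = 0" if "\<alpha> \<in> S \<rightarrow>\<^sub>E {..<k}" for \<alpha>
    using that by (rule radical_monomials_independent)
qed

text \<open>
  If \<open>c\<^sub>\<alpha> \<noteq> 0\<close>, choose \<open>z\<close> that is neither a zero of \<open>c\<^sub>\<alpha>\<close> nor a branch point.  Over it every coordinate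
  \<open>x\<^sub>j\<close> takes \<open>k\<close> values independently of the others, so that the points of the curve form a grid.
\<close>

lemma reduced_zero_if_vanishes:
  assumes F: "homogeneous n d F" "reduced F"
    and van: "\<And>x. on_cone (\<lambda>c. c) x \<Longrightarrow> x \<in> nonzero_vecs n \<Longrightarrow> meval F x = 0"
  shows "F = 0"
proof (rule reduced_zero_if_coeff_polys_zero[OF F], rule ccontr)
  fix \<alpha> assume \<alpha>: "\<alpha> \<in> S \<rightarrow>\<^sub>E {..<k}" and "coeff_poly F \<alpha> \<noteq> 0"
  hence "coeff_poly F \<alpha> * (\<Prod>j\<in>S. branch j) \<noteq> 0"
    using branch_nonzero by auto
  then obtain z where "poly (coeff_poly F \<alpha> * (\<Prod>j\<in>S. branch j)) z \<noteq> 0"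
    by (rule alg_closed_nonroot_exists)
  hence "poly (coeff_poly F \<alpha>) z \<noteq> 0 \<and> (\<Prod>j\<in>S. poly (branch j) z) \<noteq> 0"
    by (simp only: poly_mult poly_prod mult_eq_0_iff de_Morgan_disj simp_thms)
  hence z: "poly (coeff_poly F \<alpha>) z \<noteq> 0" and "(\<Prod>j\<in>S. poly (branch j) z) \<noteq> 0"
    by blast+
  hence z': "poly (branch j) z \<noteq> 0" if "j \<in> S" for j
    using that by (metis prod_zero_iff finite_atLeastAtMost)
  define Y where "Y j = {t. t ^ k = poly (branch j) z}" for j
  have "poly (coeff_poly F \<alpha>) z = 0"
  proof (rule coeffs_zero_if_vanishes_on_grid[where S = S and Y = Y and k = k and c = "\<lambda>\<alpha>. poly (coeff_poly F \<alpha>) z"])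
    show "k \<le> card (Y j)" if "j \<in> S" for j
      unfolding Y_def using card_nth_roots[OF _ of_nat_k z'[OF that]] k_ge_2 by simp
    fix v assume v: "v \<in> Pi S Y"
    define x where "x = (\<lambda>i\<in>{1..n+1}. if i = 1 then 1 else if i = 2 then z else v i)"
    have x: "x 1 = 1" "x 2 = z" "\<And>j. j \<in> S \<Longrightarrow> x j = v j"
      using n_ge_2 by (auto simp: x_def)
    have "x \<in> nonzero_vecs n"
      by (auto simp: nonzero_vecs_def x_def intro!: bexI[of _ 1])
    moreover have "on_cone (\<lambda>c. c) x"
      using v x by (auto simp: on_cone_def Y_def poly_branch Pi_iff)
    ultimately have "peval (\<lambda>c. c) x F = 0"
      using van by (simp flip: meval_eq_peval)
    moreover have "(\<Prod>j\<in>S. x j ^ \<alpha> j) = (\<Prod>j\<in>S. v j ^ \<alpha> j)" for \<alpha>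
      using x(3) by (intro prod.cong) auto
    ultimately show "(\<Sum>\<alpha>\<in>S \<rightarrow>\<^sub>E {..<k}. poly (coeff_poly F \<alpha>) z * (\<Prod>j\<in>S. v j ^ \<alpha> j)) = 0"
      using peval_reduced[OF F, of x "\<lambda>c. c"] x
      by (simp add: coeff_poly_def poly_sum poly_monom)
  qed (use \<alpha> in auto)
  with z show False by blast
qed

section \<open>Vanishing on the curve\<close>

lemma on_cone_iff:
  fixes x :: "nat \<Rightarrow> 'a"
  shows "on_cone (\<lambda>c. c) x \<longleftrightarrow> x 1 ^ k + x 2 ^ k + x 3 ^ k = 0 \<and>
     (\<forall>i\<in>{1..n-2}. lam i * x 1 ^ k + x 2 ^ k + x (i + 3) ^ k = 0)"
proof -
  have "S = insert 3 ((\<lambda>i. i + 3) ` {1..n-2})"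
  proof (intro equalityI subsetI)
    fix j assume "j \<in> S"
    thus "j \<in> insert 3 ((\<lambda>i. i + 3) ` {1..n-2})"
      by (auto simp: image_iff intro!: bexI[of _ "j - 3"])
  qed (use n_ge_2 in auto)
  hence "on_cone (\<lambda>c. c) x \<longleftrightarrow> mu 3 * x 1 ^ k + x 2 ^ k + x 3 ^ k = 0 \<and>
      (\<forall>i\<in>{1..n-2}. mu (i + 3) * x 1 ^ k + x 2 ^ k + x (i + 3) ^ k = 0)"
    by (simp only: on_cone_def ball_simps)
  thus ?thesis
    by (simp add: mu_def)
qed

lemma curve_pointD:
  assumes "P \<in> curve" "x \<in> P"
  shows "x \<in> nonzero_vecs n" "on_cone (\<lambda>c. c) x" "P = proj_rel n `` {x}"
proof -
  have P: "P \<in> nonzero_vecs n // proj_rel n"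
    using assms(1) by (simp add: gf_curve_def proj_space_def)
  show "x \<in> nonzero_vecs n"
    using in_quotient_imp_subset[OF equiv_proj_rel P] assms(2) by blast
  show "on_cone (\<lambda>c. c) x"
    using assms by (simp add: gf_curve_def on_cone_iff)
  show "P = proj_rel n `` {x}"
    using P assms(2) equiv_class_eq_iff[OF equiv_proj_rel] equiv_proj_rel
    by (metis Image_singleton_iff equiv_class_eq quotientE)
qed

lemma curve_pointI:
  assumes "x \<in> nonzero_vecs n" "on_cone (\<lambda>c. c) x"
  shows "proj_rel n `` {x} \<in> curve" "x \<in> proj_rel n `` {x}"
proof -
  show "x \<in> proj_rel n `` {x}"
    using equiv_class_self[OF equiv_proj_rel assms(1)] .
  have "on_cone (\<lambda>c. c) x'" if x': "x' \<in> proj_rel n `` {x}" for x'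
  proof -
    obtain c where c: "\<forall>i\<in>{1..n+1}. x' i = c * x i"
      using x' by (auto simp: proj_rel_def)
    have "mu j * x' 1 ^ k + x' 2 ^ k + x' j ^ k = c ^ k * (mu j * x 1 ^ k + x 2 ^ k + x j ^ k)"
      if "j \<in> S" for j
      using c that n_ge_2 by (simp add: power_mult_distrib algebra_simps)
    thus ?thesis
      using assms(2) by (simp add: on_cone_def)
  qed
  thus "proj_rel n `` {x} \<in> curve"
    using assms(1) by (auto simp: gf_curve_def proj_space_def on_cone_iff intro: quotientI)
qed

lemma curve_point_nonempty: "P \<in> curve \<Longrightarrow> \<exists>x. x \<in> P"
  using equiv_proj_rel in_quotient_imp_non_empty[of "nonzero_vecs n" "proj_rel n" P]
  by (auto simp: gf_curve_def proj_space_def)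

lemma vanishes_on_iff:
  "vanishes_on curve F \<longleftrightarrow> (\<forall>x. on_cone (\<lambda>c. c) x \<longrightarrow> x \<in> nonzero_vecs n \<longrightarrow> meval F x = 0)"
  unfolding vanishes_on_def using curve_pointD curve_pointI by metis

text \<open>
  The power series point is generic, and the curve is irreducible.  Both conditions say that
  the reduced form of \<open>F\<close> is zero.
\<close>

theorem vanishes_on_iff_generic:
  assumes "homogeneous n d F"
  shows "vanishes_on curve F \<longleftrightarrow> peval fps_const generic F = 0"
proof -
  obtain G where G: "homogeneous n d G" "reduced G" "cone_congruent F G"
    using reduced_form_exists[OF assms] .
  have generic: "peval fps_const generic F = peval fps_const generic G"
    using G(3) generic_on_cone by (simp add: cone_congruent_def)
  have point: "meval F x = meval G x" if "on_cone (\<lambda>c. c) x" for x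
  proof -
    have "on_cone fps_const (\<lambda>i. fps_const (x i))"
      using that unfolding on_cone_def
      by (metis fps_const_add fps_const_mult fps_const_power fps_const_0_eq_0)
    hence "peval fps_const (\<lambda>i. fps_const (x i)) F = peval fps_const (\<lambda>i. fps_const (x i)) G"
      using G(3) unfolding cone_congruent_def by blast
    thus ?thesis
      by (simp add: peval_const_point)
  qed
  show ?thesis
  proof
    assume "vanishes_on curve F"
    hence "G = 0"
      using reduced_zero_if_vanishes[OF G(1,2)] point by (simp add: vanishes_on_iff)
    thus "peval fps_const generic F = 0"
      using generic by simp
  next
    assume "peval fps_const generic F = 0"
    hence "G = 0"
      using generic reduced_zero_if_generic_zero[OF G(1,2)] by simp
    thus "vanishes_on curve F"
      using point by (simp add: vanishes_on_iff meval_eq_peval)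
  qed
qed

end

section \<open>Kaehler differentials and derivations\<close>

lemma module_free_module:
  assumes "cring R"
  shows "module R (free_module R)"
proof -
  interpret R: cring R by fact
  let ?M = "free_module R"
  have supp_add: "finite {g \<in> carrier R. u g \<oplus>\<^bsub>R\<^esub> v g \<noteq> \<zero>\<^bsub>R\<^esub>}"
    if "finite {g \<in> carrier R. u g \<noteq> \<zero>\<^bsub>R\<^esub>}" "finite {g \<in> carrier R. v g \<noteq> \<zero>\<^bsub>R\<^esub>}" for u v
    by (rule finite_subset[OF _ finite_UnI[OF that]]) auto
  have supp_smult: "finite {g \<in> carrier R. a \<otimes>\<^bsub>R\<^esub> u g \<noteq> \<zero>\<^bsub>R\<^esub>}"
    if "finite {g \<in> carrier R. u g \<noteq> \<zero>\<^bsub>R\<^esub>}" "a \<in> carrier R" for a u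
    by (rule finite_subset[OF _ that(1)]) (use that in auto)
  have supp_neg: "finite {g \<in> carrier R. \<ominus>\<^bsub>R\<^esub> u g \<noteq> \<zero>\<^bsub>R\<^esub>}"
    if "finite {g \<in> carrier R. u g \<noteq> \<zero>\<^bsub>R\<^esub>}" for u
    by (rule finite_subset[OF _ that]) auto
  show ?thesis
  proof (rule moduleI)
    show "abelian_group ?M"
    proof (rule abelian_groupI)
      fix u assume u: "u \<in> carrier ?M"
      show "\<exists>v\<in>carrier ?M. v \<oplus>\<^bsub>?M\<^esub> u = \<zero>\<^bsub>?M\<^esub>"
      proof (rule bexI)
        show "(\<lambda>g\<in>carrier R. \<ominus>\<^bsub>R\<^esub> u g) \<in> carrier ?M"
          using u supp_neg[of u] by (auto simp: free_module_def PiE_iff cong: conj_cong)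
        show "(\<lambda>g\<in>carrier R. \<ominus>\<^bsub>R\<^esub> u g) \<oplus>\<^bsub>?M\<^esub> u = \<zero>\<^bsub>?M\<^esub>"
          using u by (auto simp: free_module_def PiE_iff fun_eq_iff R.l_neg)
      qed
      show "\<zero>\<^bsub>?M\<^esub> \<oplus>\<^bsub>?M\<^esub> u = u"
        using u by (auto simp: free_module_def PiE_iff extensional_def fun_eq_iff)
    qed (auto simp: free_module_def PiE_iff fun_eq_iff R.a_ac supp_add cong: conj_cong)
  qed (use assms in \<open>auto simp: free_module_def PiE_iff extensional_def fun_eq_iff R.l_distr R.r_distr
      R.m_assoc supp_smult cong: conj_cong\<close>)
qed

lemma free_gen_in_carrier:
  assumes "cring R" "f \<in> carrier R"
  shows "free_gen R f \<in> carrier (free_module R)"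
proof -
  interpret R: cring R by fact
  have "finite {g \<in> carrier R. free_gen R f g \<noteq> \<zero>\<^bsub>R\<^esub>}"
    by (rule finite_subset[of _ "{f}"]) (auto simp: free_gen_def)
  thus ?thesis
    by (auto simp: free_module_def free_gen_def)
qed

text \<open>
  A homomorphism \<open>\<phi>\<close> from \<open>R\<close> to another ring together with a derivation \<open>D\<close> along \<open>\<phi>\<close> that vanishes on
  \<open>K\<close>.  The target is a ring of a type class and serves as an \<open>R\<close>-module through \<open>\<phi>\<close>.
\<close>

locale derivation_over = cring R for R (structure) +
  fixes K and \<phi> :: "'a \<Rightarrow> 'f::comm_ring_1" and D :: "'a \<Rightarrow> 'f"
  assumes K_subset: "K \<subseteq> carrier R"
    and \<phi>_add: "\<lbrakk>a \<in> carrier R; b \<in> carrier R\<rbrakk> \<Longrightarrow> \<phi> (a \<oplus> b) = \<phi> a + \<phi> b"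
    and \<phi>_mult: "\<lbrakk>a \<in> carrier R; b \<in> carrier R\<rbrakk> \<Longrightarrow> \<phi> (a \<otimes> b) = \<phi> a * \<phi> b"
    and \<phi>_one: "\<phi> \<one> = 1"
    and D_add: "\<lbrakk>a \<in> carrier R; b \<in> carrier R\<rbrakk> \<Longrightarrow> D (a \<oplus> b) = D a + D b"
    and D_mult: "\<lbrakk>a \<in> carrier R; b \<in> carrier R\<rbrakk> \<Longrightarrow> D (a \<otimes> b) = \<phi> a * D b + \<phi> b * D a"
    and D_const: "a \<in> K \<Longrightarrow> D a = 0"
begin

abbreviation "M \<equiv> free_module R"
abbreviation "N \<equiv> kaehler_rels R K"

sublocale M: module R M
  by (rule module_free_module) (rule is_cring)

lemma \<phi>_zero: "\<phi> \<zero> = 0"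
  using \<phi>_add[of \<zero> \<zero>] by simp

text \<open>
  The linear extension of \<open>D\<close> to the free module, which takes the generator of \<open>g\<close> to \<open>D g\<close>.
\<close>

definition functional :: "('a \<Rightarrow> 'a) \<Rightarrow> 'f" where
  "functional u = (\<Sum>g | g \<in> carrier R \<and> u g \<noteq> \<zero>. \<phi> (u g) * D g)"

lemma functional_superset:
  assumes "finite A" "A \<subseteq> carrier R" "{g \<in> carrier R. u g \<noteq> \<zero>} \<subseteq> A"
  shows "functional u = (\<Sum>g\<in>A. \<phi> (u g) * D g)"
  unfolding functional_def
  by (rule sum.mono_neutral_left) (use assms \<phi>_zero in auto)

lemma carrier_M:
  assumes "u \<in> carrier M"
  shows "finite {g \<in> carrier R. u g \<noteq> \<zero>}" "g \<in> carrier R \<Longrightarrow> u g \<in> carrier R"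
  using assms by (auto simp: free_module_def)

lemma functional_add:
  assumes u: "u \<in> carrier M" and v: "v \<in> carrier M"
  shows "functional (u \<oplus>\<^bsub>M\<^esub> v) = functional u + functional v"
proof -
  let ?A = "{g \<in> carrier R. u g \<noteq> \<zero>} \<union> {g \<in> carrier R. v g \<noteq> \<zero>}"
  have fin: "finite ?A"
    using carrier_M(1)[OF u] carrier_M(1)[OF v] by simp
  have "functional (u \<oplus>\<^bsub>M\<^esub> v) = (\<Sum>g\<in>?A. \<phi> ((u \<oplus>\<^bsub>M\<^esub> v) g) * D g)"
    using fin by (intro functional_superset) (auto simp: free_module_def)
  also have "\<dots> = (\<Sum>g\<in>?A. \<phi> (u g) * D g + \<phi> (v g) * D g)"
    using carrier_M(2)[OF u] carrier_M(2)[OF v]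
    by (intro sum.cong) (auto simp: free_module_def \<phi>_add algebra_simps)
  also have "\<dots> = functional u + functional v"
    using functional_superset[OF fin, of u] functional_superset[OF fin, of v]
    by (simp add: sum.distrib Collect_mono_iff subset_iff)
  finally show ?thesis .
qed

lemma functional_smult:
  assumes a: "a \<in> carrier R" and u: "u \<in> carrier M"
  shows "functional (a \<odot>\<^bsub>M\<^esub> u) = \<phi> a * functional u"
proof -
  let ?A = "{g \<in> carrier R. u g \<noteq> \<zero>}"
  have "functional (a \<odot>\<^bsub>M\<^esub> u) = (\<Sum>g\<in>?A. \<phi> ((a \<odot>\<^bsub>M\<^esub> u) g) * D g)"
    using carrier_M(1)[OF u] a by (intro functional_superset) (auto simp: free_module_def)
  also have "\<dots> = \<phi> a * functional u"
    unfolding functional_def sum_distrib_left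
    using carrier_M(2)[OF u] a
    by (intro sum.cong) (auto simp: free_module_def \<phi>_mult algebra_simps)
  finally show ?thesis .
qed

lemma functional_zero: "functional \<zero>\<^bsub>M\<^esub> = 0"
  using functional_add[of "\<zero>\<^bsub>M\<^esub>" "\<zero>\<^bsub>M\<^esub>"] by simp

lemma functional_neg:
  assumes "u \<in> carrier M"
  shows "functional (\<ominus>\<^bsub>M\<^esub> u) = - functional u"
  using functional_add[of u "\<ominus>\<^bsub>M\<^esub> u"] assms
  by (simp add: M.M.r_neg functional_zero eq_neg_iff_add_eq_0 add.commute)

lemma functional_free_gen:
  assumes "f \<in> carrier R"
  shows "functional (free_gen R f) = D f"
proof -
  have "functional (free_gen R f) = (\<Sum>g\<in>{f}. \<phi> (free_gen R f g) * D g)"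
    using assms by (intro functional_superset) (auto simp: free_gen_def)
  thus ?thesis
    using assms by (simp add: free_gen_def \<phi>_one)
qed

lemma free_gen_closed [simp]: "f \<in> carrier R \<Longrightarrow> free_gen R f \<in> carrier M"
  by (rule free_gen_in_carrier) (rule is_cring)

lemma kaehler_gens_subset: "kaehler_gens R K \<subseteq> carrier M"
  using K_subset unfolding kaehler_gens_def Let_def
  by (auto intro!: M.M.minus_closed M.M.a_closed M.smult_closed)

lemma submodule_N: "submodule N R M"
proof (rule M.submoduleI)
  have carrier: "submodule (carrier M) R M"
    by (rule M.carrier_is_submodule)
  show "N \<subseteq> carrier M"
    unfolding kaehler_rels_def by (rule hull_minimal[where S = "\<lambda>N. submodule N R M"]) (fact kaehler_gens_subset carrier)+
  show "\<zero>\<^bsub>M\<^esub> \<in> N"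
    unfolding kaehler_rels_def hull_def
    using subgroup.one_closed[OF submodule.axioms(1)] by fastforce
  show "\<ominus>\<^bsub>M\<^esub> u \<in> N" if "u \<in> N" for u
    using that M.submoduleE(3) unfolding kaehler_rels_def hull_def by blast
  show "u \<oplus>\<^bsub>M\<^esub> v \<in> N" if "u \<in> N" "v \<in> N" for u v
    using that M.submoduleE(5) unfolding kaehler_rels_def hull_def by blast
  show "a \<odot>\<^bsub>M\<^esub> u \<in> N" if "a \<in> carrier R" "u \<in> N" for a u
    using that M.submoduleE(4) unfolding kaehler_rels_def hull_def by blast
qed

text \<open>
  This is the universal property of the differentials: the kernel is a submodule, and it contains
  the generating relations because \<open>D\<close> is additive, satisfies the Leibniz rule and vanishes on \<open>K\<close>.
\<close>

lemma functional_vanishes_on_N: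
  assumes "u \<in> N"
  shows "functional u = 0"
proof -
  let ?Ker = "{u \<in> carrier M. functional u = 0}"
  have "submodule ?Ker R M"
    by (rule M.submoduleI) (auto simp: functional_zero functional_neg functional_add functional_smult)
  moreover have "kaehler_gens R K \<subseteq> ?Ker"
  proof
    fix u assume u: "u \<in> kaehler_gens R K"
    hence "functional u = 0"
      using K_subset unfolding kaehler_gens_def Let_def
      by (auto simp: a_minus_def functional_add functional_neg functional_smult functional_free_gen
          D_add D_mult D_const subset_iff)
    thus "u \<in> ?Ker"
      using u kaehler_gens_subset by auto
  qed
  ultimately have "N \<subseteq> ?Ker"
    unfolding kaehler_rels_def by (intro hull_minimal) 
  thus ?thesis using assms by blast
qed

lemma N_subset: "N \<subseteq> carrier M"
  by (rule M.submoduleE(1)[OF submodule_N])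

lemma zero_in_N: "\<zero>\<^bsub>M\<^esub> \<in> N"
  using subgroup.one_closed[OF submodule.axioms(1)[OF submodule_N]] by simp

lemma coset_iff: "v \<in> N +>\<^bsub>M\<^esub> u \<longleftrightarrow> (\<exists>r\<in>N. v = r \<oplus>\<^bsub>M\<^esub> u)"
  by (auto simp: a_r_coset_def' )

lemma coset_self: "u \<in> carrier M \<Longrightarrow> u \<in> N +>\<^bsub>M\<^esub> u"
  using zero_in_N by (force simp: coset_iff)

lemma coset_add_N:
  assumes "r \<in> N" "u \<in> carrier M"
  shows "N +>\<^bsub>M\<^esub> (r \<oplus>\<^bsub>M\<^esub> u) = N +>\<^bsub>M\<^esub> u"
proof -
  have N: "s \<oplus>\<^bsub>M\<^esub> t \<in> N" "\<ominus>\<^bsub>M\<^esub> s \<in> N" if "s \<in> N" "t \<in> N" for s t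
    using M.submoduleE(3,5)[OF submodule_N] that by auto
  show ?thesis
  proof (intro equalityI subsetI)
    fix v assume "v \<in> N +>\<^bsub>M\<^esub> (r \<oplus>\<^bsub>M\<^esub> u)"
    then obtain s where s: "s \<in> N" "v = s \<oplus>\<^bsub>M\<^esub> (r \<oplus>\<^bsub>M\<^esub> u)"
      unfolding coset_iff by blast
    hence "v = (s \<oplus>\<^bsub>M\<^esub> r) \<oplus>\<^bsub>M\<^esub> u"
      using assms N_subset by (simp add: M.M.a_assoc subset_iff)
    thus "v \<in> N +>\<^bsub>M\<^esub> u"
      using N s(1) assms(1) unfolding coset_iff by blast
  next
    fix v assume "v \<in> N +>\<^bsub>M\<^esub> u"
    then obtain s where s: "s \<in> N" "v = s \<oplus>\<^bsub>M\<^esub> u"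
      unfolding coset_iff by blast
    hence "v = (s \<oplus>\<^bsub>M\<^esub> \<ominus>\<^bsub>M\<^esub> r) \<oplus>\<^bsub>M\<^esub> (r \<oplus>\<^bsub>M\<^esub> u)"
      using assms N_subset by (simp add: M.M.a_assoc M.M.r_neg1 M.M.r_neg2 subset_iff)
    thus "v \<in> N +>\<^bsub>M\<^esub> (r \<oplus>\<^bsub>M\<^esub> u)"
      using N s(1) assms(1) unfolding coset_iff by blast
  qed
qed

lemma kaehler_smult_coset:
  assumes a: "a \<in> carrier R" and u: "u \<in> carrier M"
  shows "a \<odot>\<^bsub>kaehler R K\<^esub> (N +>\<^bsub>M\<^esub> u) = N +>\<^bsub>M\<^esub> (a \<odot>\<^bsub>M\<^esub> u)"
proof -
  have "N +>\<^bsub>M\<^esub> (a \<odot>\<^bsub>M\<^esub> v) = N +>\<^bsub>M\<^esub> (a \<odot>\<^bsub>M\<^esub> u)" if v: "v \<in> N +>\<^bsub>M\<^esub> u" for v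
  proof -
    obtain r where r: "r \<in> N" "v = r \<oplus>\<^bsub>M\<^esub> u"
      using v unfolding coset_iff by blast
    hence "a \<odot>\<^bsub>M\<^esub> v = (a \<odot>\<^bsub>M\<^esub> r) \<oplus>\<^bsub>M\<^esub> (a \<odot>\<^bsub>M\<^esub> u)"
      using a u N_subset by (simp add: M.smult_r_distr subset_iff)
    moreover have "a \<odot>\<^bsub>M\<^esub> r \<in> N"
      using M.submoduleE(4)[OF submodule_N a r(1)] .
    ultimately show ?thesis
      using coset_add_N a u by simp
  qed
  moreover have "N +>\<^bsub>M\<^esub> u \<noteq> {}"
    using coset_self[OF u] by blast
  ultimately have "(\<Union>v\<in>N +>\<^bsub>M\<^esub> u. N +>\<^bsub>M\<^esub> (a \<odot>\<^bsub>M\<^esub> v)) = N +>\<^bsub>M\<^esub> (a \<odot>\<^bsub>M\<^esub> u)"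
    by (metis (no_types, lifting) SUP_eq_const)
  thus ?thesis
    by (simp add: kaehler_def Let_def)
qed

lemma kaehler_smult_d:
  assumes "a \<in> carrier R" "f \<in> carrier R"
  shows "a \<odot>\<^bsub>kaehler R K\<^esub> kaehler_d R K f = N +>\<^bsub>M\<^esub> (a \<odot>\<^bsub>M\<^esub> free_gen R f)"
  using assms unfolding kaehler_d_def by (intro kaehler_smult_coset) auto

lemma kaehler_smult_smult_d:
  assumes "a \<in> carrier R" "b \<in> carrier R" "f \<in> carrier R"
  shows "a \<odot>\<^bsub>kaehler R K\<^esub> (b \<odot>\<^bsub>kaehler R K\<^esub> kaehler_d R K f)
    = (a \<otimes> b) \<odot>\<^bsub>kaehler R K\<^esub> kaehler_d R K f"
  using assms by (simp add: kaehler_smult_d kaehler_smult_coset M.smult_assoc1)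

theorem kaehler_smult_d_eqD:
  assumes "a \<in> carrier R" "b \<in> carrier R" "f \<in> carrier R"
    and "a \<odot>\<^bsub>kaehler R K\<^esub> kaehler_d R K f = b \<odot>\<^bsub>kaehler R K\<^esub> kaehler_d R K f"
  shows "\<phi> a * D f = \<phi> b * D f"
proof -
  have "a \<odot>\<^bsub>M\<^esub> free_gen R f \<in> N +>\<^bsub>M\<^esub> (b \<odot>\<^bsub>M\<^esub> free_gen R f)"
    using assms coset_self[of "a \<odot>\<^bsub>M\<^esub> free_gen R f"] by (simp add: kaehler_smult_d)
  then obtain r where "r \<in> N" "a \<odot>\<^bsub>M\<^esub> free_gen R f = r \<oplus>\<^bsub>M\<^esub> (b \<odot>\<^bsub>M\<^esub> free_gen R f)"
    unfolding coset_iff by blast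
  hence "functional (a \<odot>\<^bsub>M\<^esub> free_gen R f) = functional (b \<odot>\<^bsub>M\<^esub> free_gen R f)"
    using assms N_subset functional_vanishes_on_N by (simp add: functional_add subset_iff)
  thus ?thesis
    using assms by (simp add: functional_smult functional_free_gen)
qed

theorem kaehler_smult_d_eq_zeroD:
  assumes "a \<in> carrier R" "f \<in> carrier R"
    and "a \<odot>\<^bsub>kaehler R K\<^esub> kaehler_d R K f = \<zero>\<^bsub>kaehler R K\<^esub>"
  shows "\<phi> a * D f = 0"
proof -
  have "a \<odot>\<^bsub>M\<^esub> free_gen R f \<in> N"
    using assms coset_self[of "a \<odot>\<^bsub>M\<^esub> free_gen R f"]
    by (simp add: kaehler_smult_d) (simp add: kaehler_def Let_def)
  from functional_vanishes_on_N[OF this] show ?thesis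
    using assms by (simp add: functional_smult functional_free_gen)
qed

end

section \<open>The function field\<close>

lemma UN_const_on: "A \<noteq> {} \<Longrightarrow> (\<And>p. p \<in> A \<Longrightarrow> B p = X) \<Longrightarrow> (\<Union>p\<in>A. B p) = X"
  by auto

context generalized_fermat
begin

abbreviation "ev \<equiv> peval fps_const generic"
abbreviation "L \<equiv> function_field n curve"
abbreviation "pairs \<equiv> rat_pairs n curve"
abbreviation "fraction \<equiv> rat_frac n curve"

definition series_quotient :: "'a mpoly \<times> 'a mpoly \<Rightarrow> 'a fls" where
  "series_quotient p = fps_to_fls (ev (fst p)) / fps_to_fls (ev (snd p))"

text \<open>
  The expansion at \<open>z = 0\<close> along the branch \<open>generic\<close>.  The choice of the representing pair is
  immaterial by \<open>rat_rel_iff\<close>.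
\<close>

definition expansion :: "'a ratfun \<Rightarrow> 'a fls" where
  "expansion f = series_quotient (SOME p. p \<in> f)"

lemma rat_pairs_iff:
  "(F, G) \<in> pairs \<longleftrightarrow> (\<exists>d. homogeneous n d F \<and> homogeneous n d G) \<and> ev G \<noteq> 0"
  using vanishes_on_iff_generic by (auto simp: rat_pairs_def)

text \<open>
  Equality of rational functions is equality of their expansions.  Hence equality of fractions
  is transitive, and identities in the function field can be checked in the field of Laurent series.
\<close>

lemma rat_rel_iff: "(p, q) \<in> rat_rel n curve \<longleftrightarrow> p \<in> pairs \<and> q \<in> pairs \<and> series_quotient p = series_quotient q"
proof -
  obtain F G F' G' where pq: "p = (F, G)" "q = (F', G')"
    by (cases p, cases q)
  have "vanishes_on curve (F * G' - F' * G) \<longleftrightarrow> series_quotient p = series_quotient q" if pairs: "p \<in> pairs" "q \<in> pairs"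
  proof -
    obtain d d' where d: "homogeneous n d F" "homogeneous n d G" "ev G \<noteq> 0"
        "homogeneous n d' F'" "homogeneous n d' G'" "ev G' \<noteq> 0"
      using pairs by (auto simp: pq rat_pairs_iff)
    have "homogeneous n (d + d') (F * G' - F' * G)"
      using homogeneous_mult[OF d(1,5)] homogeneous_mult[OF d(4,2)]
      by (simp add: homogeneous_diff add.commute)
    hence "vanishes_on curve (F * G' - F' * G) \<longleftrightarrow> ev F * ev G' = ev F' * ev G"
      by (simp add: vanishes_on_iff_generic series.peval_diff series.peval_mult)
    also have "\<dots> \<longleftrightarrow> series_quotient p = series_quotient q"
      using d by (simp add: series_quotient_def pq frac_eq_eq flip: fls_times_fps_to_fls)
    finally show ?thesis .
  qed
  thus ?thesis
    by (auto simp: rat_rel_def pq)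
qed

lemma mem_fraction_iff: "p \<in> fraction F G \<longleftrightarrow> (F, G) \<in> pairs \<and> p \<in> pairs \<and> series_quotient p = series_quotient (F, G)"
  by (auto simp: rat_frac_def rat_rel_iff)

lemma fraction_eqI: "p \<in> pairs \<Longrightarrow> q \<in> pairs \<Longrightarrow> series_quotient p = series_quotient q \<Longrightarrow> fraction (fst p) (snd p) = fraction (fst q) (snd q)"
  by (cases p, cases q) (auto simp: mem_fraction_iff)

lemma fraction_closed: "(F, G) \<in> pairs \<Longrightarrow> fraction F G \<in> carrier L"
  by (auto simp: function_field_def rat_frac_def intro: quotientI)

lemma carrier_cases:
  assumes "f \<in> carrier L"
  obtains F G where "(F, G) \<in> pairs" "f = fraction F G"
  using assms by (auto simp: function_field_def rat_frac_def elim!: quotientE)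

lemma expansion_fraction:
  assumes "(F, G) \<in> pairs"
  shows "expansion (fraction F G) = series_quotient (F, G)"
proof -
  define p where "p = (SOME p. p \<in> fraction F G)"
  have "(F, G) \<in> fraction F G"
    using assms by (simp add: mem_fraction_iff)
  hence "p \<in> fraction F G"
    unfolding p_def by (rule someI)
  hence "series_quotient p = series_quotient (F, G)"
    by (simp add: mem_fraction_iff)
  thus ?thesis
    by (simp only: expansion_def p_def)
qed

lemma expansion_inj: "f \<in> carrier L \<Longrightarrow> g \<in> carrier L \<Longrightarrow> expansion f = expansion g \<Longrightarrow> f = g"
proof -
  assume *: "f \<in> carrier L" "g \<in> carrier L" "expansion f = expansion g"
  obtain F G where f: "(F, G) \<in> pairs" "f = fraction F G"
    using *(1) by (rule carrier_cases)
  obtain F' G' where g: "(F', G') \<in> pairs" "g = fraction F' G'"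
    using *(2) by (rule carrier_cases)
  show "f = g"
    using fraction_eqI[OF f(1) g(1)] f g *(3) by (simp add: expansion_fraction)
qed

lemma expansion_eq_iff: "f \<in> carrier L \<Longrightarrow> g \<in> carrier L \<Longrightarrow> f = g \<longleftrightarrow> expansion f = expansion g"
  using expansion_inj by blast

lemma pairs_mult:
  assumes "(F, G) \<in> pairs" "(F', G') \<in> pairs"
  shows "(F * F', G * G') \<in> pairs" "series_quotient (F * F', G * G') = series_quotient (F, G) * series_quotient (F', G')"
proof -
  show "(F * F', G * G') \<in> pairs"
    using assms homogeneous_mult unfolding rat_pairs_iff series.peval_mult by fastforce
  show "series_quotient (F * F', G * G') = series_quotient (F, G) * series_quotient (F', G')"
    by (simp add: series_quotient_def series.peval_mult fls_times_fps_to_fls)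
qed

lemma pairs_add:
  assumes "(F, G) \<in> pairs" "(F', G') \<in> pairs"
  shows "(F * G' + F' * G, G * G') \<in> pairs" "series_quotient (F * G' + F' * G, G * G') = series_quotient (F, G) + series_quotient (F', G')"
proof -
  obtain d d' where d: "homogeneous n d F" "homogeneous n d G" "ev G \<noteq> 0"
      "homogeneous n d' F'" "homogeneous n d' G'" "ev G' \<noteq> 0"
    using assms by (auto simp: rat_pairs_iff)
  have "homogeneous n (d + d') (F * G' + F' * G)" "homogeneous n (d + d') (G * G')"
    using homogeneous_mult[OF d(1,5)] homogeneous_mult[OF d(4,2)] homogeneous_mult[OF d(2,5)]
    by (simp_all add: homogeneous_add add.commute)
  thus "(F * G' + F' * G, G * G') \<in> pairs"
    using d by (auto simp: rat_pairs_iff series.peval_mult)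
  show "series_quotient (F * G' + F' * G, G * G') = series_quotient (F, G) + series_quotient (F', G')"
    using d by (simp add: series_quotient_def series.peval_mult series.peval_add fls_times_fps_to_fls add_frac_eq)
qed

lemma const_pair: "(mconst c, 1) \<in> pairs"
  using homogeneous_mconst homogeneous_1 by (auto simp: rat_pairs_iff)

lemma const_pair_01: "(0, 1) \<in> pairs" "(1, 1) \<in> pairs"
  using homogeneous_1 by (auto simp: rat_pairs_iff)

lemma fraction_mult:
  assumes "(F, G) \<in> pairs" "(F', G') \<in> pairs"
  shows "fraction F G \<otimes>\<^bsub>L\<^esub> fraction F' G' = fraction (F * F') (G * G')"
proof -
  have ne: "fraction F G \<noteq> {}" "fraction F' G' \<noteq> {}"
    using assms mem_fraction_iff by blast+
  have "fraction (A * A') (B * B') = fraction (F * F') (G * G')"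
    if "(A, B) \<in> fraction F G" "(A', B') \<in> fraction F' G'" for A B A' B'
    using that fraction_eqI[of "(A * A', B * B')" "(F * F', G * G')"] pairs_mult assms
    by (simp add: mem_fraction_iff)
  thus ?thesis
    unfolding function_field_def monoid.simps
    by (intro UN_const_on ne) (auto intro!: UN_const_on ne)
qed

lemma fraction_add:
  assumes "(F, G) \<in> pairs" "(F', G') \<in> pairs"
  shows "fraction F G \<oplus>\<^bsub>L\<^esub> fraction F' G' = fraction (F * G' + F' * G) (G * G')"
proof -
  have ne: "fraction F G \<noteq> {}" "fraction F' G' \<noteq> {}"
    using assms mem_fraction_iff by blast+
  have "fraction (A * B' + A' * B) (B * B') = fraction (F * G' + F' * G) (G * G')"
    if "(A, B) \<in> fraction F G" "(A', B') \<in> fraction F' G'" for A B A' B'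
    using that fraction_eqI[of "(A * B' + A' * B, B * B')" "(F * G' + F' * G, G * G')"] pairs_add assms
    by (simp add: mem_fraction_iff)
  thus ?thesis
    unfolding function_field_def ring.simps
    by (intro UN_const_on ne) (auto intro!: UN_const_on ne)
qed

lemma one_L: "\<one>\<^bsub>L\<^esub> = fraction 1 1" and zero_L: "\<zero>\<^bsub>L\<^esub> = fraction 0 1"
  by (simp_all add: function_field_def)

lemma L_closed:
  "f \<in> carrier L \<Longrightarrow> g \<in> carrier L \<Longrightarrow> f \<otimes>\<^bsub>L\<^esub> g \<in> carrier L"
  "f \<in> carrier L \<Longrightarrow> g \<in> carrier L \<Longrightarrow> f \<oplus>\<^bsub>L\<^esub> g \<in> carrier L"
  "\<one>\<^bsub>L\<^esub> \<in> carrier L" "\<zero>\<^bsub>L\<^esub> \<in> carrier L"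
  by (auto elim!: carrier_cases simp: fraction_mult fraction_add one_L zero_L
      intro!: fraction_closed pairs_mult pairs_add const_pair_01)

lemma expansion_hom:
  "f \<in> carrier L \<Longrightarrow> g \<in> carrier L \<Longrightarrow> expansion (f \<otimes>\<^bsub>L\<^esub> g) = expansion f * expansion g"
  "f \<in> carrier L \<Longrightarrow> g \<in> carrier L \<Longrightarrow> expansion (f \<oplus>\<^bsub>L\<^esub> g) = expansion f + expansion g"
  "expansion \<one>\<^bsub>L\<^esub> = 1" "expansion \<zero>\<^bsub>L\<^esub> = 0"
  by (auto elim!: carrier_cases simp: fraction_mult fraction_add one_L zero_L expansion_fraction pairs_mult
      pairs_add const_pair_01)
     (simp_all add: series_quotient_def)

lemma negative_exists:
  assumes "f \<in> carrier L"
  shows "\<exists>g\<in>carrier L. expansion g = - expansion f"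
proof -
  obtain F G where FG: "(F, G) \<in> pairs" "f = fraction F G"
    using assms by (rule carrier_cases)
  hence "(- F, G) \<in> pairs"
    using homogeneous_uminus by (auto simp: rat_pairs_iff)
  thus ?thesis
    using FG by (intro bexI[of _ "fraction (- F) G"])
      (auto simp: expansion_fraction fraction_closed series_quotient_def series.peval_uminus)
qed

lemma inverse_exists:
  assumes "f \<in> carrier L" "expansion f \<noteq> 0"
  shows "\<exists>g\<in>carrier L. expansion g = inverse (expansion f)"
proof -
  obtain F G where FG: "(F, G) \<in> pairs" "f = fraction F G"
    using assms(1) by (rule carrier_cases)
  hence "(G, F) \<in> pairs"
    using assms(2) by (auto simp: rat_pairs_iff expansion_fraction series_quotient_def)
  thus ?thesis
    using FG by (intro bexI[of _ "fraction G F"]) (auto simp: expansion_fraction fraction_closed series_quotient_def)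
qed

lemma cring_L: "cring L"
proof (rule cringI)
  show "abelian_group L"
  proof (rule abelian_groupI)
    fix f assume "f \<in> carrier L"
    then obtain g where "g \<in> carrier L" "expansion g = - expansion f"
      using negative_exists by blast
    thus "\<exists>g\<in>carrier L. g \<oplus>\<^bsub>L\<^esub> f = \<zero>\<^bsub>L\<^esub>"
      using \<open>f \<in> carrier L\<close> by (intro bexI[of _ g] expansion_inj) (auto simp: L_closed expansion_hom)
  qed (simp_all add: expansion_eq_iff L_closed expansion_hom add_ac)
  show "comm_monoid L"
    by (rule comm_monoidI) (simp_all add: expansion_eq_iff L_closed expansion_hom mult_ac)
qed (simp_all add: expansion_eq_iff L_closed expansion_hom algebra_simps)

text \<open>
  A fraction with nonzero expansion has a numerator that does not vanish identically, so it can be inverted.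
\<close>

lemma field_L: "field L"
proof (rule cring.cring_fieldI[OF cring_L])
  interpret cring L by (rule cring_L)
  show "Units L = carrier L - {\<zero>\<^bsub>L\<^esub>}"
  proof (intro equalityI subsetI)
    fix f assume "f \<in> Units L"
    then obtain g where fg: "f \<in> carrier L" "g \<in> carrier L" "f \<otimes>\<^bsub>L\<^esub> g = \<one>\<^bsub>L\<^esub>"
      by (auto simp: Units_def)
    hence "expansion f * expansion g = 1"
      by (metis expansion_hom(1,3))
    thus "f \<in> carrier L - {\<zero>\<^bsub>L\<^esub>}"
      using fg expansion_hom(4) by auto
  next
    fix f assume f: "f \<in> carrier L - {\<zero>\<^bsub>L\<^esub>}"
    hence "expansion f \<noteq> 0"
      using expansion_inj[of f "\<zero>\<^bsub>L\<^esub>"] expansion_hom(4) by auto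
    then obtain g where g: "g \<in> carrier L" "expansion g = inverse (expansion f)"
      using inverse_exists f by blast
    have "f \<otimes>\<^bsub>L\<^esub> g = \<one>\<^bsub>L\<^esub>"
      using f g \<open>expansion f \<noteq> 0\<close> by (intro expansion_inj) (auto simp: expansion_hom)
    thus "f \<in> Units L"
      using f g m_comm[of f g] by (auto simp: Units_def intro!: bexI[of _ g])
  qed
qed

sublocale L: field L
  by (rule field_L)

sublocale forms: derivation_over L "constant_field n curve" expansion "\<lambda>f. fls_deriv (expansion f)"
proof
  show "constant_field n curve \<subseteq> carrier L"
    using const_pair by (auto simp: constant_field_def fraction_closed)
  show "fls_deriv (expansion f) = 0" if "f \<in> constant_field n curve" for f
    using that const_pair
    by (auto simp: constant_field_def expansion_fraction series_quotient_def fls_deriv_fps_to_fls)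
qed (auto simp: expansion_hom algebra_simps)

lemma expansion_pow: "f \<in> carrier L \<Longrightarrow> expansion (f [^]\<^bsub>L\<^esub> (m::nat)) = expansion f ^ m"
  by (induction m) (auto simp: expansion_hom)

lemma expansion_finprod:
  assumes "finite A" "\<And>i. i \<in> A \<Longrightarrow> g i \<in> carrier L"
  shows "expansion (\<Otimes>\<^bsub>L\<^esub>i\<in>A. g i) = (\<Prod>i\<in>A. expansion (g i))"
  using assms
proof (induction A)
  case (insert i A)
  moreover have "g \<in> A \<rightarrow> carrier L"
    using insert by auto
  ultimately show ?case
    by (simp add: L.finprod_insert expansion_hom L.finprod_closed)
qed (simp add: expansion_hom)

lemma expansion_inv:
  assumes "f \<in> carrier L" "expansion f \<noteq> 0"
  shows "inv\<^bsub>L\<^esub> f \<in> carrier L" "expansion (inv\<^bsub>L\<^esub> f) = inverse (expansion f)"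
proof -
  have f: "f \<in> Units L"
    using assms expansion_hom(4) by (auto simp: L.field_Units)
  thus "inv\<^bsub>L\<^esub> f \<in> carrier L"
    by simp
  hence "expansion f * expansion (inv\<^bsub>L\<^esub> f) = 1"
    using f assms by (metis L.Units_r_inv expansion_hom(1,3))
  thus "expansion (inv\<^bsub>L\<^esub> f) = inverse (expansion f)"
    by (metis inverse_unique)
qed

section \<open>The coordinate functions\<close>

definition coord :: "nat \<Rightarrow> 'a fls" where
  "coord i = fps_to_fls (generic i)"

lemma reduced_mvar: "reduced (mvar i)"
  using k_ge_2 by (auto simp: reduced_def mvar_def lookup_single when_def)

text \<open>
  The polynomial \<open>x\<^sub>i\<close> is reduced because \<open>1 < k\<close>, so it does not vanish at the generic point.
\<close>

lemma coord_nonzero: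
  assumes "i \<in> {1..n+1}"
  shows "coord i \<noteq> 0"
proof
  assume "coord i = 0"
  hence "mvar i = (0 :: 'a mpoly)"
    using assms reduced_zero_if_generic_zero[OF homogeneous_mvar reduced_mvar, of i]
    by (simp add: coord_def)
  hence "Poly_Mapping.lookup (mvar i :: 'a mpoly) (Poly_Mapping.single i 1) = 0"
    by simp
  thus False
    by (simp add: mvar_def)
qed

lemma coord_inj:
  assumes "i \<in> {1..n+1}" "j \<in> {1..n+1}" "coord i = coord j"
  shows "i = j"
proof -
  have "mvar i - mvar j = (0 :: 'a mpoly)"
    using assms(3)
    by (intro reduced_zero_if_generic_zero[of 1] homogeneous_diff homogeneous_mvar assms(1,2)
        reduced_diff reduced_mvar) (simp add: coord_def series.peval_diff)
  hence "(mvar j :: 'a mpoly) = mvar i"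
    by simp
  hence "Poly_Mapping.lookup (mvar j :: 'a mpoly) (Poly_Mapping.single i 1) = 1"
    by (simp only: mvar_def lookup_single_eq)
  hence "Poly_Mapping.single j (1::nat) = Poly_Mapping.single i 1"
    by (simp add: mvar_def lookup_single when_def split: if_splits)
  hence "Poly_Mapping.lookup (Poly_Mapping.single j (1::nat)) i = 1"
    by (metis lookup_single_eq)
  thus "i = j"
    by (simp add: lookup_single when_def split: if_splits)
qed

lemma mvar_pair: "i \<in> {1..n+1} \<Longrightarrow> j \<in> {1..n+1} \<Longrightarrow> (mvar i, mvar j) \<in> pairs"
  using homogeneous_mvar[of i n] homogeneous_mvar[of j n] coord_nonzero[of j]
  by (auto simp: rat_pairs_iff coord_def)

lemma series_quotient_mvar: "series_quotient (mvar i, mvar j) = coord i / coord j"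
  by (simp add: series_quotient_def coord_def)

lemma gf_coord_closed: "j \<in> {1..n+1} \<Longrightarrow> gf_coord k n lam j \<in> carrier L"
  and expansion_gf_coord: "j \<in> {1..n+1} \<Longrightarrow> expansion (gf_coord k n lam j) = coord j"
  using mvar_pair[of j 1]
  by (auto simp: gf_coord_def fraction_closed expansion_fraction series_quotient_mvar) (simp add: coord_def generic_def)

section \<open>The one-forms\<close>

definition dz :: "'a one_form" where
  "dz = dform n curve (gf_coord k n lam 2)"

definition form_coeff :: "nat \<Rightarrow> (nat \<Rightarrow> nat) \<Rightarrow> 'a ratfun" where
  "form_coeff r \<alpha> = gf_coord k n lam 2 [^]\<^bsub>L\<^esub> r \<otimes>\<^bsub>L\<^esub>
     inv\<^bsub>L\<^esub> (\<Otimes>\<^bsub>L\<^esub>j\<in>S. gf_coord k n lam j [^]\<^bsub>L\<^esub> \<alpha> j)"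

lemma gf_form_eq: "gf_form k n lam r \<alpha> = form_coeff r \<alpha> \<odot>\<^bsub>one_forms n curve\<^esub> dz"
  by (simp only: gf_form_def form_coeff_def dz_def Let_def)

lemma form_coeff:
  "form_coeff r \<alpha> \<in> carrier L"
  "expansion (form_coeff r \<alpha>) = coord 2 ^ r / (\<Prod>j\<in>S. coord j ^ \<alpha> j)"
proof -
  define p where "p = (\<Otimes>\<^bsub>L\<^esub>j\<in>S. gf_coord k n lam j [^]\<^bsub>L\<^esub> \<alpha> j)"
  have closed: "gf_coord k n lam j [^]\<^bsub>L\<^esub> \<alpha> j \<in> carrier L" if "j \<in> S" for j
    using that by (intro L.nat_pow_closed gf_coord_closed) auto
  hence p: "p \<in> carrier L"
    unfolding p_def by (intro L.finprod_closed) auto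
  have "expansion p = (\<Prod>j\<in>S. expansion (gf_coord k n lam j [^]\<^bsub>L\<^esub> \<alpha> j))"
    unfolding p_def using closed by (intro expansion_finprod) auto
  also have "\<dots> = (\<Prod>j\<in>S. coord j ^ \<alpha> j)"
    by (intro prod.cong refl) (auto simp: expansion_pow gf_coord_closed expansion_gf_coord)
  finally have expansion_p: "expansion p = (\<Prod>j\<in>S. coord j ^ \<alpha> j)" .
  moreover have "coord j \<noteq> 0" if "j \<in> S" for j
    using that by (intro coord_nonzero) auto
  ultimately have "expansion p \<noteq> 0"
    by (simp only: prod_zero_iff finite_atLeastAtMost power_eq_0_iff simp_thms) blast
  note inv = expansion_inv[OF p this]
  have z: "gf_coord k n lam 2 \<in> carrier L" "expansion (gf_coord k n lam 2) = coord 2"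
    using n_ge_2 by (auto simp: gf_coord_closed expansion_gf_coord)
  show "form_coeff r \<alpha> \<in> carrier L"
    unfolding form_coeff_def p_def[symmetric] using inv z by simp
  show "expansion (form_coeff r \<alpha>) = coord 2 ^ r / (\<Prod>j\<in>S. coord j ^ \<alpha> j)"
    unfolding form_coeff_def p_def[symmetric] expansion_p[symmetric]
    using inv z by (simp add: expansion_hom expansion_pow divide_inverse)
qed

lemma deriv_z: "fls_deriv (expansion (gf_coord k n lam 2)) = 1"
  using n_ge_2 by (simp add: expansion_gf_coord coord_def generic_def fls_deriv_fps_to_fls)

lemma z_closed: "gf_coord k n lam 2 \<in> carrier L"
  using n_ge_2 by (simp add: gf_coord_closed)

text \<open>
  The derivative of \<open>z\<close> along the branch is \<open>1\<close>, so the functional induced by \<open>d/dt\<close> takes \<open>f dz\<close> to the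
  expansion of \<open>f\<close>.
\<close>

lemma smult_dz_eq_iff:
  assumes "f \<in> carrier L" "g \<in> carrier L"
  shows "f \<odot>\<^bsub>one_forms n curve\<^esub> dz = g \<odot>\<^bsub>one_forms n curve\<^esub> dz \<longleftrightarrow> f = g"
  using forms.kaehler_smult_d_eqD[OF assms z_closed] expansion_inj[OF assms] deriv_z
  by (auto simp: one_forms_def dz_def dform_def)

lemma smult_dz_nonzero:
  assumes "f \<in> carrier L" "expansion f \<noteq> 0"
  shows "f \<odot>\<^bsub>one_forms n curve\<^esub> dz \<noteq> \<zero>\<^bsub>one_forms n curve\<^esub>"
  using forms.kaehler_smult_d_eq_zeroD[OF assms(1) z_closed] assms(2) deriv_z
  by (auto simp: one_forms_def dz_def dform_def)

lemma form_ratio_smult_dz: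
  assumes "f \<in> carrier L" "g \<in> carrier L" "h \<in> carrier L" "expansion g \<noteq> 0"
    and "expansion f = expansion h * expansion g"
  shows "form_ratio n curve (f \<odot>\<^bsub>one_forms n curve\<^esub> dz) (g \<odot>\<^bsub>one_forms n curve\<^esub> dz) = h"
proof -
  have "f \<odot>\<^bsub>one_forms n curve\<^esub> dz = e \<odot>\<^bsub>one_forms n curve\<^esub> (g \<odot>\<^bsub>one_forms n curve\<^esub> dz) \<longleftrightarrow> e = h"
    if e: "e \<in> carrier L" for e
  proof -
    have "e \<odot>\<^bsub>one_forms n curve\<^esub> (g \<odot>\<^bsub>one_forms n curve\<^esub> dz) = (e \<otimes>\<^bsub>L\<^esub> g) \<odot>\<^bsub>one_forms n curve\<^esub> dz"
      using forms.kaehler_smult_smult_d[OF e assms(2) z_closed]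
      by (simp add: one_forms_def dz_def dform_def)
    hence "f \<odot>\<^bsub>one_forms n curve\<^esub> dz = e \<odot>\<^bsub>one_forms n curve\<^esub> (g \<odot>\<^bsub>one_forms n curve\<^esub> dz)
        \<longleftrightarrow> f = e \<otimes>\<^bsub>L\<^esub> g"
      using smult_dz_eq_iff[of f "e \<otimes>\<^bsub>L\<^esub> g"] assms e by simp
    also have "\<dots> \<longleftrightarrow> expansion f = expansion e * expansion g"
      using expansion_inj[of f "e \<otimes>\<^bsub>L\<^esub> g"] assms e by (auto simp: expansion_hom)
    also have "\<dots> \<longleftrightarrow> e = h"
      using assms e expansion_inj[of e h] by auto
    finally show ?thesis .
  qed
  thus ?thesis
    unfolding form_ratio_def using assms(3) by (intro the_equality) auto
qed

section \<open>Values of coordinate ratios\<close>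

lemma meval_mvar: "meval (mvar i) x = (x i :: 'a)"
  by (simp add: meval_eq_peval)

text \<open>
  Values of fractions do not depend on the homogeneous coordinates, so they can be computed at any fixed
  representative \<open>x\<close> of the point.
\<close>

lemma ratio_on_class:
  assumes P: "P \<in> curve" "x \<in> P" "x' \<in> P" and FG: "(F, G) \<in> pairs" and "meval G x' \<noteq> 0"
  shows "meval G x \<noteq> 0" "meval F x' / meval G x' = meval F x / meval G x"
proof -
  have "x' \<in> proj_rel n `` {x}"
    using curve_pointD(3)[OF P(1,2)] P(3) by simp
  then obtain c where c: "c \<noteq> 0" "\<And>i. i \<in> {1..n+1} \<Longrightarrow> x' i = c * x i"
    by (auto simp: proj_rel_def)
  obtain d where d: "homogeneous n d F" "homogeneous n d G"
    using FG by (auto simp: rat_pairs_iff)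
  have "meval E x' = c ^ d * meval E x" if "homogeneous n d E" for E
    unfolding meval_eq_peval point.peval_scale[OF that, symmetric]
    using c(2) by (intro point.peval_cong[OF that])
  thus "meval G x \<noteq> 0" "meval F x' / meval G x' = meval F x / meval G x"
    using d c(1) assms(5) by auto
qed

lemma regular_atE:
  assumes "P \<in> curve" "x \<in> P" "f \<in> carrier L" "regular_at f P"
  obtains F G where "(F, G) \<in> f" "meval G x \<noteq> 0"
proof -
  obtain F G x' where *: "(F, G) \<in> f" "x' \<in> P" "meval G x' \<noteq> 0"
    using assms(4) by (auto simp: regular_at_def)
  moreover have "(F, G) \<in> pairs"
    using *(1) assms(3) by (auto elim!: carrier_cases simp: mem_fraction_iff)
  ultimately show ?thesis
    using that ratio_on_class(1)[OF assms(1,2)] by blast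
qed

lemma cross_mult_on_curve:
  assumes "P \<in> curve" "x \<in> P" "(F, G) \<in> f" "(F', G') \<in> f" "f \<in> carrier L"
  shows "meval F x * meval G' x = meval F' x * meval G x"
proof -
  have "((F, G), (F', G')) \<in> rat_rel n curve"
    using assms(3-5) by (auto elim!: carrier_cases simp: mem_fraction_iff rat_rel_iff)
  hence "vanishes_on curve (F * G' - F' * G)"
    by (auto simp: rat_rel_def)
  hence "meval (F * G' - F' * G) x = 0"
    using assms(1,2) by (auto simp: vanishes_on_def)
  thus ?thesis
    by (simp add: meval_eq_peval point.peval_diff point.peval_mult)
qed

lemma value_at_eq:
  assumes "P \<in> curve" "x \<in> P" "f \<in> carrier L" "(F, G) \<in> f" "meval G x \<noteq> 0"
  shows "value_at f P = meval F x / meval G x"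
  unfolding value_at_def
proof (rule the_equality)
  fix v assume "\<exists>(F, G)\<in>f. \<exists>x\<in>P. meval G x \<noteq> 0 \<and> v = meval F x / meval G x"
  then obtain F' G' x' where *: "(F', G') \<in> f" "x' \<in> P" "meval G' x' \<noteq> 0" "v = meval F' x' / meval G' x'"
    by auto
  have "(F', G') \<in> pairs"
    using *(1) assms(3) by (auto elim!: carrier_cases simp: mem_fraction_iff)
  hence "meval G' x \<noteq> 0" "v = meval F' x / meval G' x"
    using ratio_on_class[OF assms(1,2) *(2) _ *(3)] *(4) by auto
  thus "v = meval F x / meval G x"
    using cross_mult_on_curve[OF assms(1,2,4) *(1) assms(3)] assms(5) by (simp add: frac_eq_eq)
qed (use assms in auto)

text \<open>
  Every representation \<open>F / G\<close> of \<open>x\<^sub>i / x\<^sub>j\<close> satisfies \<open>F x\<^sub>j = x\<^sub>i G\<close> on the curve.  This also holds at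
  points with \<open>x\<^sub>j = 0\<close>, where it forces \<open>x\<^sub>i = 0\<close> if the ratio is regular.
\<close>

lemma value_at_coord_ratio:
  assumes "P \<in> curve" "x \<in> P" "i \<in> {1..n+1}" "j \<in> {1..n+1}" "regular_at (fraction (mvar i) (mvar j)) P"
  shows "value_at (fraction (mvar i) (mvar j)) P * x j = x i"
proof -
  have f: "fraction (mvar i) (mvar j) \<in> carrier L" "(mvar i, mvar j) \<in> fraction (mvar i) (mvar j)"
    using mvar_pair[OF assms(3,4)] by (auto simp: fraction_closed mem_fraction_iff)
  obtain F G where FG: "(F, G) \<in> fraction (mvar i) (mvar j)" "meval G x \<noteq> 0"
    using regular_atE[OF assms(1,2) f(1) assms(5)] .
  show ?thesis
    using value_at_eq[OF assms(1,2) f(1) FG] cross_mult_on_curve[OF assms(1,2) FG(1) f(2,1)] FG(2)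
    by (simp add: meval_mvar)
qed

lemma regular_at_coord_ratio:
  assumes "x \<in> P" "i \<in> {1..n+1}" "j \<in> {1..n+1}" "x j \<noteq> 0"
  shows "regular_at (fraction (mvar i) (mvar j)) P"
  unfolding regular_at_def
  using assms mvar_pair[OF assms(2,3)]
  by (intro bexI[of _ "(mvar i, mvar j)"]) (auto simp: mem_fraction_iff meval_mvar)

lemma proj_point_eq:
  assumes "P \<in> curve" "x \<in> P" "c \<noteq> 0" "\<And>i. i \<in> {1..n+1} \<Longrightarrow> v i = c * x i"
  shows "proj_point n v = P"
proof -
  note x = curve_pointD[OF assms(1,2)]
  obtain i where "i \<in> {1..n+1}" "x i \<noteq> 0"
    using x(1) by (auto simp: nonzero_vecs_def)
  hence "restrict v {1..n+1} \<in> nonzero_vecs n"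
    using assms(3,4) by (auto simp: nonzero_vecs_def intro!: bexI[of _ i])
  hence "(x, restrict v {1..n+1}) \<in> proj_rel n"
    using x(1) assms(3,4) by (auto simp: proj_rel_def)
  thus ?thesis
    using equiv_class_eq[OF equiv_proj_rel] x(3) by (metis proj_point_def)
qed

lemma morphism_identity: "morphism n curve n (\<lambda>P\<in>curve. P)"
  unfolding morphism_def
proof (intro conjI ballI)
  show "(\<lambda>P\<in>curve. P) \<in> curve \<rightarrow>\<^sub>E proj_space n"
    by (auto simp: gf_curve_def)
  fix P assume "P \<in> curve"
  show "\<exists>d e H F. homogeneous n e H \<and> (\<forall>i\<in>{1..n+1}. homogeneous n d (F i)) \<and>
      (\<forall>x\<in>P. meval H x \<noteq> 0) \<and>
      (\<forall>Q\<in>curve. \<forall>x\<in>Q. meval H x \<noteq> 0 \<longrightarrow> (\<exists>i\<in>{1..n+1}. meval (F i) x \<noteq> 0) \<and>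
         (\<lambda>P\<in>curve. P) Q = proj_point n (\<lambda>i. meval (F i) x))"
  proof (rule exI[of _ 1], rule exI[of _ 0], rule exI[of _ "1 :: 'a mpoly"], rule exI[of _ mvar],
      intro conjI ballI impI homogeneous_1 homogeneous_mvar)
    fix Q x assume Q: "Q \<in> curve" "x \<in> Q"
    show "\<exists>i\<in>{1..n+1}. meval (mvar i) x \<noteq> 0"
      using curve_pointD(1)[OF Q] by (auto simp: nonzero_vecs_def meval_mvar)
    show "(\<lambda>P\<in>curve. P) Q = proj_point n (\<lambda>i. meval (mvar i) x)"
      using Q proj_point_eq[OF Q, of 1 x] by (simp add: meval_mvar)
  qed (auto simp: meval_eq_peval)
qed

section \<open>The forms with coordinate ratios\<close>

text \<open>
  Only the ratios \<open>\<theta>\<^sub>i / \<theta>\<^sub>j = x\<^sub>i / x\<^sub>j\<close> matter.  Every point has a nonzero coordinate \<open>x\<^sub>j\<close>, and the ratios with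
  this denominator are regular there; so a map given by the forms is determined at every point, without
  extension by continuity.
\<close>

theorem map_of_forms_iff_identity:
  assumes coeff: "\<And>i. i \<in> {1..n+1} \<Longrightarrow> c i \<in> carrier L"
      "\<And>i. i \<in> {1..n+1} \<Longrightarrow> expansion (c i) = coord i * w" and "w \<noteq> 0"
    and \<theta>: "\<And>i. i \<in> {1..n+1} \<Longrightarrow> \<theta> i = c i \<odot>\<^bsub>one_forms n curve\<^esub> dz"
  shows "map_of_forms n curve n \<theta> \<phi> \<longleftrightarrow> \<phi> = (\<lambda>P\<in>curve. P)"
proof -
  have c0: "expansion (c i) \<noteq> 0" if "i \<in> {1..n+1}" for i
    using coeff(2)[OF that] coord_nonzero[OF that] \<open>w \<noteq> 0\<close> by simp
  have \<theta>0: "\<theta> i \<noteq> \<zero>\<^bsub>one_forms n curve\<^esub>" if "i \<in> {1..n+1}" for i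
    using smult_dz_nonzero[OF coeff(1)[OF that] c0[OF that]] \<theta>[OF that] by simp
  have ratio: "form_ratio n curve (\<theta> i) (\<theta> j) = fraction (mvar i) (mvar j)"
    if ij: "i \<in> {1..n+1}" "j \<in> {1..n+1}" for i j
    unfolding \<theta>[OF ij(1)] \<theta>[OF ij(2)]
    using mvar_pair[OF ij] coord_nonzero[OF ij(2)] coeff ij c0
    by (intro form_ratio_smult_dz) (auto simp: fraction_closed expansion_fraction series_quotient_mvar)
  have regular_value: "proj_point n (\<lambda>i. value_at (form_ratio n curve (\<theta> i) (\<theta> j)) P) = P"
    if j: "j \<in> {1..n+1}" and P: "P \<in> curve"
      and reg: "\<forall>i\<in>{1..n+1}. regular_at (form_ratio n curve (\<theta> i) (\<theta> j)) P" for j P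
  proof -
    obtain x where x: "x \<in> P"
      using curve_point_nonempty[OF P] by blast
    have val: "value_at (form_ratio n curve (\<theta> i) (\<theta> j)) P * x j = x i" if "i \<in> {1..n+1}" for i
      using value_at_coord_ratio[OF P x that j] reg that j by (simp add: ratio)
    \<comment> \<open>otherwise all coordinates of \<open>x\<close> would vanish by \<open>val\<close>\<close>
    have "x j \<noteq> 0"
      using val curve_pointD(1)[OF P x] by (auto simp: nonzero_vecs_def)
    thus ?thesis
      using val by (intro proj_point_eq[OF P x, of "inverse (x j)"]) (auto simp: field_simps)
  qed
  show ?thesis
  proof
    assume map: "map_of_forms n curve n \<theta> \<phi>"
    hence "\<phi> \<in> curve \<rightarrow>\<^sub>E proj_space n"
      by (auto simp: map_of_forms_def morphism_def)
    moreover have "\<phi> P = P" if P: "P \<in> curve" for P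
    proof -
      obtain x where x: "x \<in> P"
        using curve_point_nonempty[OF P] by blast
      obtain j where j: "j \<in> {1..n+1}" "x j \<noteq> 0"
        using curve_pointD(1)[OF P x] by (auto simp: nonzero_vecs_def)
      have "\<forall>i\<in>{1..n+1}. regular_at (form_ratio n curve (\<theta> i) (\<theta> j)) P"
        using regular_at_coord_ratio[OF x _ j] ratio j by simp
      thus ?thesis
        using map \<theta>0 j(1) P regular_value[OF j(1) P] unfolding map_of_forms_def by metis
    qed
    ultimately show "\<phi> = (\<lambda>P\<in>curve. P)"
      by (intro ext) (auto simp: PiE_iff extensional_def restrict_def)
  next
    assume "\<phi> = (\<lambda>P\<in>curve. P)"
    thus "map_of_forms n curve n \<theta> \<phi>"
      using morphism_identity regular_value \<theta>0[of 1] by (auto simp: map_of_forms_def)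
  qed
qed

text \<open>
  All exponents are maximal except the one at \<open>i\<close>; since \<open>j\<close> ranges over \<open>S\<close>, they are all maximal if
  \<open>i\<close> is 1 or 2.
\<close>

definition theta_exponents :: "nat \<Rightarrow> nat \<Rightarrow> nat" where
  "theta_exponents i j = (if i = j then k - 2 else k - 1)"

definition theta :: "nat \<Rightarrow> 'a one_form" where
  "theta i = gf_form k n lam (if i = 2 then 1 else 0) (theta_exponents i)"

text \<open>
  The common factor of the forms: \<open>\<theta>\<^sub>i\<close> expands to \<open>x\<^sub>i\<close> times \<open>weight dz\<close>.
\<close>

definition weight :: "'a fls" where
  "weight = inverse (\<Prod>j\<in>S. coord j ^ (k - 1))"

lemma weight_nonzero: "weight \<noteq> 0"
proof -
  have "coord j ^ (k - 1) \<noteq> 0" if "j \<in> S" for j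
    using that coord_nonzero[of j] by simp
  hence "(\<Prod>j\<in>S. coord j ^ (k - 1)) \<noteq> 0"
    using prod_zero_iff[OF finite_atLeastAtMost[of 3 "n + 1"], of "\<lambda>j. coord j ^ (k - 1)"] by blast
  thus ?thesis
    unfolding weight_def by (rule nonzero_imp_inverse_nonzero)
qed

lemma expansion_theta:
  assumes i: "i \<in> {1..n+1}"
  shows "expansion (form_coeff (if i = 2 then 1 else 0) (theta_exponents i))
    = coord i * weight"
proof (cases "i \<in> S")
  case True
  have nz: "coord j \<noteq> 0" if "j \<in> S" for j
    using that by (intro coord_nonzero) auto
  have "(\<Prod>j\<in>S. coord j ^ (k - 1)) = coord i ^ (k - 1) * (\<Prod>j\<in>S - {i}. coord j ^ (k - 1))"
    using True by (intro prod.remove) auto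
  also have "coord i ^ (k - 1) = coord i * coord i ^ (k - 2)"
    using k_ge_2 by (metis Suc_diff_Suc Suc_1 Suc_le_eq diff_Suc_1 power_Suc numeral_2_eq_2 One_nat_def)
  also have "\<dots> * (\<Prod>j\<in>S - {i}. coord j ^ (k - 1))
      = coord i * (coord i ^ theta_exponents i i * (\<Prod>j\<in>S - {i}. coord j ^ theta_exponents i j))"
    by (simp add: theta_exponents_def mult.assoc)
  also have "\<dots> = coord i * (\<Prod>j\<in>S. coord j ^ theta_exponents i j)"
    using True by (subst prod.remove[of S i]) auto
  finally have "(\<Prod>j\<in>S. coord j ^ (k - 1)) = coord i * (\<Prod>j\<in>S. coord j ^ theta_exponents i j)" .
  thus ?thesis
    using True nz[OF True] by (simp add: form_coeff(2) divide_inverse weight_def)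
next
  case False
  hence "i = 1 \<or> i = 2"
    using i by auto
  moreover have "(\<Prod>j\<in>S. coord j ^ theta_exponents i j) = (\<Prod>j\<in>S. coord j ^ (k - 1))"
    using False by (intro prod.cong) (auto simp: theta_exponents_def)
  ultimately show ?thesis
    by (auto simp: form_coeff(2) divide_inverse coord_def generic_def weight_def)
qed

text \<open>
  The sum of the exponents is \<open>(k - 1) (n - 1) \<ge> 3\<close> for \<open>i = 1, 2\<close>, which leaves room for \<open>r = 1\<close>, and one less for
  the other forms, which have \<open>r = 0\<close>.
\<close>

lemma theta_in_standard_basis:
  assumes genus: "(k - 1) * (n - 1) > 2" and i: "i \<in> {1..n+1}"
  shows "theta i \<in> standard_basis k n lam"
proof -
  define s where "s = (\<Sum>j\<in>S. int (theta_exponents i j))"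
  have "card S = n - 1"
    by simp
  hence sum: "(\<Sum>j\<in>S. int (k - 1)) = int ((k - 1) * (n - 1))"
    by (simp only: sum_constant of_nat_mult mult.commute)
  have "int (if i = 2 then 1 else 0) \<le> s - 2"
  proof (cases "i \<in> S")
    case True
    have "s = int (k - 2) + (\<Sum>j\<in>S - {i}. int (k - 1))"
      unfolding s_def using True by (subst sum.remove[of S i]) (auto simp: theta_exponents_def)
    moreover have "(\<Sum>j\<in>S. int (k - 1)) = int (k - 1) + (\<Sum>j\<in>S - {i}. int (k - 1))"
      using True by (intro sum.remove) auto
    moreover have "int (k - 2) = int (k - 1) - 1"
      using k_ge_2 by simp
    ultimately have "s \<ge> 2"
      using sum genus by linarith
    moreover have "i \<noteq> 2"
      using True by auto
    ultimately show ?thesis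
      by simp
  next
    case False
    hence "s = (\<Sum>j\<in>S. int (k - 1))"
      unfolding s_def by (intro sum.cong) (auto simp: theta_exponents_def)
    hence "s \<ge> 3"
      using sum genus by linarith
    thus ?thesis
      by simp
  qed
  moreover have "\<forall>j\<in>S. theta_exponents i j \<in> {0..k-1}"
    by (auto simp: theta_exponents_def)
  ultimately show ?thesis
    unfolding standard_basis_def theta_def s_def by blast
qed

lemma theta_inj: "inj_on theta {1..n+1}"
proof (rule inj_onI)
  fix i j assume ij: "i \<in> {1..n+1}" "j \<in> {1..n+1}" and eq: "theta i = theta j"
  have "form_coeff (if i = 2 then 1 else 0) (theta_exponents i)
      = form_coeff (if j = 2 then 1 else 0) (theta_exponents j)"
    using eq smult_dz_eq_iff[OF form_coeff(1) form_coeff(1)] by (simp add: theta_def gf_form_eq)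
  hence "coord i * weight = coord j * weight"
    using expansion_theta[OF ij(1)] expansion_theta[OF ij(2)] by (simp only:)
  thus "i = j"
    using weight_nonzero coord_inj[OF ij] by simp
qed

lemma map_of_theta: "map_of_forms n curve n theta \<phi> \<longleftrightarrow> \<phi> = (\<lambda>P\<in>curve. P)"
proof (rule map_of_forms_iff_identity)
  show "form_coeff (if i = 2 then 1 else 0) (theta_exponents i) \<in> carrier L" for i
    by (rule form_coeff)
  show "expansion (form_coeff (if i = 2 then 1 else 0) (theta_exponents i))
      = coord i * weight" if "i \<in> {1..n+1}" for i
    using that by (rule expansion_theta)
  show "theta i = form_coeff (if i = 2 then 1 else 0) (theta_exponents i) \<odot>\<^bsub>one_forms n curve\<^esub> dz" for i
    by (simp only: theta_def gf_form_eq)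
  show "weight \<noteq> 0"
    by (rule weight_nonzero)
qed

end

theorem proposition1:
  fixes k n :: nat and lam :: "nat \<Rightarrow> 'a::alg_closed_field"
  assumes "k \<ge> 2" and "n \<ge> 2" and "(k - 1) * (n - 1) > 2"
    and "CHAR('a) > 0 \<longrightarrow> coprime k CHAR('a)"
    and "\<forall>i\<in>{1..n-2}. lam i \<notin> {0, 1}"
    and "inj_on lam {1..n-2}"
  shows "\<exists>\<theta> :: nat \<Rightarrow> 'a one_form.
    inj_on \<theta> {1..n+1} \<and>
    \<theta> ` {1..n+1} \<subseteq> standard_basis k n lam \<and>
    (\<forall>\<phi>. map_of_forms n (gf_curve k n lam) n \<theta> \<phi> \<longleftrightarrow> \<phi> = (\<lambda>P\<in>gf_curve k n lam. P))"
proof -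
  interpret generalized_fermat k n lam
    using assms by unfold_locales auto
  show ?thesis
    using theta_inj theta_in_standard_basis[OF assms(3)] map_of_theta
    by (intro exI[of _ theta]) blast
qed

end
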